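(* Let $\mu=(\mu_1,\dots,\mu_k)\vdash n$ and $a=(a_1,\dots,a_h)\vDash n$ with $\mu\unrhd\lambda(a)$. Let $r\in R(\mu,a)$ with $r\le s(\mu,a)$. Define $a^i$, $l_i$, $\mu^i$ inductively by $a^0=a$, $l_0=r$, $\mu^0=\mu$, and for $0\le i<n$: $$a^{i+1}=\widetilde{a^i},\qquad l_{i+1}=\begin{cases} l(\mu^i,a^i,1)&\text{if } i\in A,\\ l(\mu^i,a^i,l_i)&\text{otherwise},\end{cases}\qquad \mu^{i+1}=(\mu^i)^{(l_{i+1})},$$ where $A=\{a_h,\ a_h+a_{h-1},\ \dots,\ a_h+a_{h-1}+\cdots+a_2\}$ (under the hypotheses these are well defined). Define a tableau $S$ of shape $\mu$ and weight $a$ by $S(l_{i+1},\mu^i_{l_{i+1}})=t$ for $0\le i<n$, where $t$ is determined by $\sum_{j=1}^{t-1}a_j<n-i\le\sum_{j=1}^t a_j$. Then $S$ is the least element of the subposet $$\{T\in\mathrm{STab}(\mu,a): \min\{i: T(i,\mu_i)=h\}\ge r\}$$ of $(\mathrm{STab}(\mu,a),\le)$. In particular, if $r=l(\mu,a)$, then $S$ is the least element of $\mathrm{STab}(\mu,a)$.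
   Context: A composition of $n$ is a sequence $a=(a_1,\dots,a_h)$ of positive integers with $\sum a_i=n$ (written $a\vDash n$); $h=h(a)$ is its height. A partition of $n$ ($\mu\vdash n$) is a non-increasing composition; by convention $\mu_i=0$ beyond its number of parts, and sequences with trailing zeros are identified with the partition obtained by deleting them. For compositions $a=(a_1,\dots,a_h)$, $b=(b_1,\dots,b_k)$ of $n$, $a\unrhd b$ means $k\ge h$ and $\sum_{i=1}^j a_i\ge\sum_{i=1}^j b_i$ for $j=1,\dots,h$; $a\rhd b$ means $a\unrhd b$, $a\neq b$. $\lambda(a)$ is the non-increasing rearrangement of $a$. For a sequence $c$ and index $i$, $c^{(i)}$ is $c$ with its $i$-th entry decreased by $1$. $\tilde a=(a_1,\dots,a_{h-1},a_h-1)$ if $a_h\ge2$ and $\tilde a=(a_1,\dots,a_{h-1})$ if $a_h=1$. $D_\mu=\{(i,j):1\le i\le k,1\le j\le \mu_i\}$. $\mathrm{STab}(\mu,a)$ is the set of maps $T:D_\mu\to\{1,\dots,h\}$ with weakly increasing rows ($T(i,j)\le T(i,j+1)$), strictly increasing columns ($T(i,j)<T(i+1,j)$) and $|T^{-1}(\{i\})|=a_i$ for all $i$. $s(\mu,a)=\max\{i:\mu_i\ge a_h\}$. $R(\mu,a)$ is the set of $i\in\{1,\dots,k\}$ such that $\mu_i>\mu_{i+1}$ and $\mu^{(i)}\unrhd\lambda(\tilde a)$; $l(\mu,a)=\min R(\mu,a)$; for $1\le i\le k$, $R(\mu,a,i)=\{r\in R(\mu,a): r\ge i\}$ and $l(\mu,a,i)=\min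 R(\mu,a,i)$. Partial order on $\mathrm{STab}(\mu,a)$: for $T,S$ and $1\le p\le h$ put $\tau^{(p)}=(|\{j:T(i,j)\le p\}|)_{i=1}^k$, $\sigma^{(p)}=(|\{j:S(i,j)\le p\}|)_{i=1}^k$; $S\le T$ iff $S=T$ or there is $p$ with $\tau^{(p')}=\sigma^{(p')}$ for all $p<p'\le h$ and $\tau^{(p)}\rhd\sigma^{(p)}$. *)

theory Defs
  imports Main "HOL-Library.FuncSet"
begin

definition is_composition :: "nat \<Rightarrow> nat list \<Rightarrow> bool" where
  "is_composition n a \<longleftrightarrow> (\<forall>x\<in>set a. 0 < x) \<and> sum_list a = n"

definition is_partition :: "nat \<Rightarrow> nat list \<Rightarrow> bool" where
  "is_partition n \<mu> \<longleftrightarrow> is_composition n \<mu> \<and> sorted_wrt (\<ge>) \<mu>"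

text \<open>Sequences are lists, but all indices are 1-based; \<open>part c i\<close> is the \<open>i\<close>-th entry,
  with the convention that it is 0 beyond the end.\<close>

definition part :: "nat list \<Rightarrow> nat \<Rightarrow> nat" where
  "part c i = (if 1 \<le> i \<and> i \<le> length c then c ! (i - 1) else 0)"

definition strip_zeros :: "nat list \<Rightarrow> nat list" where
  "strip_zeros c = rev (dropWhile (\<lambda>x. x = 0) (rev c))"

definition dominates :: "nat list \<Rightarrow> nat list \<Rightarrow> bool"  (infix "\<unrhd>" 50) where
  "a \<unrhd> b \<longleftrightarrow> length a \<le> length b \<and>
     (\<forall>j\<in>{1..length a}. sum_list (take j b) \<le> sum_list (take j a))"

definition strictly_dominates :: "nat list \<Rightarrow> nat list \<Rightarrow> bool"  (infix "\<rhd>" 50) where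
  "a \<rhd> b \<longleftrightarrow> a \<unrhd> b \<and> a \<noteq> b"

definition nonincr_rearr :: "nat list \<Rightarrow> nat list" where
  "nonincr_rearr a = rev (sort a)"

text \<open>\<open>c\<^sup>(\<^sup>i\<^sup>)\<close>. Trailing zeros are deleted, so that for a partition \<open>c\<close> with \<open>c\<^sub>i > c\<^sub>i\<^sub>+\<^sub>1\<close>
  the result is again a partition, as needed for the height condition in \<open>\<unrhd>\<close>.\<close>

definition dec_part :: "nat list \<Rightarrow> nat \<Rightarrow> nat list" where
  "dec_part c i = strip_zeros (c[i - 1 := c ! (i - 1) - 1])"

definition tilde :: "nat list \<Rightarrow> nat list" where
  "tilde a = (if last a \<ge> 2 then butlast a @ [last a - 1] else butlast a)"

definition diagram :: "nat list \<Rightarrow> (nat \<times> nat) set" where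
  "diagram \<mu> = {(i, j). 1 \<le> i \<and> i \<le> length \<mu> \<and> 1 \<le> j \<and> j \<le> part \<mu> i}"

text \<open>Tableaux are functions on the diagram, extended by \<open>undefined\<close> outside of it, so that
  equality of tableaux is equality of functions.\<close>

definition STab :: "nat list \<Rightarrow> nat list \<Rightarrow> (nat \<times> nat \<Rightarrow> nat) set" where
  "STab \<mu> a = {T \<in> diagram \<mu> \<rightarrow>\<^sub>E {1..length a}.
     (\<forall>i j. (i, j) \<in> diagram \<mu> \<and> (i, j + 1) \<in> diagram \<mu> \<longrightarrow> T (i, j) \<le> T (i, j + 1)) \<and>
     (\<forall>i j. (i, j) \<in> diagram \<mu> \<and> (i + 1, j) \<in> diagram \<mu> \<longrightarrow> T (i, j) < T (i + 1, j)) \<and>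
     (\<forall>t\<in>{1..length a}. card {c \<in> diagram \<mu>. T c = t} = part a t)}"

definition s_index :: "nat list \<Rightarrow> nat list \<Rightarrow> nat" where
  "s_index \<mu> a = Max {i \<in> {1..length \<mu>}. part \<mu> i \<ge> last a}"

definition R_set :: "nat list \<Rightarrow> nat list \<Rightarrow> nat set" where
  "R_set \<mu> a = {i \<in> {1..length \<mu>}. part \<mu> i > part \<mu> (i + 1) \<and>
     dec_part \<mu> i \<unrhd> nonincr_rearr (tilde a)}"

definition l_min :: "nat list \<Rightarrow> nat list \<Rightarrow> nat" where
  "l_min \<mu> a = Min (R_set \<mu> a)"

definition R_set_from :: "nat list \<Rightarrow> nat list \<Rightarrow> nat \<Rightarrow> nat set" where
  "R_set_from \<mu> a i = {r \<in> R_set \<mu> a. r \<ge> i}"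

definition l_min_from :: "nat list \<Rightarrow> nat list \<Rightarrow> nat \<Rightarrow> nat" where
  "l_min_from \<mu> a i = Min (R_set_from \<mu> a i)"

text \<open>The partition \<open>\<tau>\<^sup>(\<^sup>p\<^sup>)\<close>.\<close>

definition row_counts :: "nat list \<Rightarrow> (nat \<times> nat \<Rightarrow> nat) \<Rightarrow> nat \<Rightarrow> nat list" where
  "row_counts \<mu> T p =
     strip_zeros (map (\<lambda>i. card {j \<in> {1..part \<mu> i}. T (i, j) \<le> p}) [1..<length \<mu> + 1])"

definition tab_le ::
  "nat list \<Rightarrow> nat list \<Rightarrow> (nat \<times> nat \<Rightarrow> nat) \<Rightarrow> (nat \<times> nat \<Rightarrow> nat) \<Rightarrow> bool" where
  "tab_le \<mu> a S T \<longleftrightarrow> S = T \<or>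
     (\<exists>p\<in>{1..length a}.
        (\<forall>p'. p < p' \<and> p' \<le> length a \<longrightarrow> row_counts \<mu> T p' = row_counts \<mu> S p') \<and>
        row_counts \<mu> T p \<rhd> row_counts \<mu> S p)"

definition is_least_tab ::
  "nat list \<Rightarrow> nat list \<Rightarrow> (nat \<times> nat \<Rightarrow> nat) set \<Rightarrow> (nat \<times> nat \<Rightarrow> nat) \<Rightarrow> bool" where
  "is_least_tab \<mu> a X S \<longleftrightarrow> S \<in> X \<and> (\<forall>T\<in>X. tab_le \<mu> a S T)"

definition A_set :: "nat list \<Rightarrow> nat set" where
  "A_set a = {\<Sum>j=m..length a. part a j | m. 2 \<le> m \<and> m \<le> length a}"

definition a_seq :: "nat list \<Rightarrow> nat \<Rightarrow> nat list" where
  "a_seq a i = (tilde ^^ i) a"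

function l_seq :: "nat list \<Rightarrow> nat list \<Rightarrow> nat \<Rightarrow> nat \<Rightarrow> nat"
  and mu_seq :: "nat list \<Rightarrow> nat list \<Rightarrow> nat \<Rightarrow> nat \<Rightarrow> nat list" where
  "l_seq \<mu> a r 0 = r"
| "l_seq \<mu> a r (Suc i) =
     (if i \<in> A_set a then l_min_from (mu_seq \<mu> a r i) (a_seq a i) 1
      else l_min_from (mu_seq \<mu> a r i) (a_seq a i) (l_seq \<mu> a r i))"
| "mu_seq \<mu> a r 0 = \<mu>"
| "mu_seq \<mu> a r (Suc i) = dec_part (mu_seq \<mu> a r i) (l_seq \<mu> a r (Suc i))"
  by pat_completeness auto
termination
  by (relation "measure (\<lambda>x. case x of Inl (_, _, _, i) \<Rightarrow> 2 * i | Inr (_, _, _, i) \<Rightarrow> 2 * i + 1)")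
     auto

text \<open>Each minimum used in the recursion is taken over a nonempty set.\<close>

definition seqs_well_defined :: "nat list \<Rightarrow> nat list \<Rightarrow> nat \<Rightarrow> bool" where
  "seqs_well_defined \<mu> a r \<longleftrightarrow> (\<forall>i < sum_list \<mu>.
     R_set_from (mu_seq \<mu> a r i) (a_seq a i) (if i \<in> A_set a then 1 else l_seq \<mu> a r i) \<noteq> {})"

definition is_constructed_tab :: "nat list \<Rightarrow> nat list \<Rightarrow> nat \<Rightarrow> (nat \<times> nat \<Rightarrow> nat) \<Rightarrow> bool" where
  "is_constructed_tab \<mu> a r S \<longleftrightarrow> S \<in> extensional (diagram \<mu>) \<and>
     (\<forall>i < sum_list \<mu>. \<exists>t\<in>{1..length a}.
        (\<Sum>j=1..<t. part a j) < sum_list \<mu> - i \<and> sum_list \<mu> - i \<le> (\<Sum>j=1..t. part a j) \<and>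
        S (l_seq \<mu> a r (i + 1), part (mu_seq \<mu> a r i) (l_seq \<mu> a r (i + 1))) = t)"

end

theory Submission
  imports "HOL-Library.Multiset" Defs
begin

text \<open>
  Everything is expressed through partial sums. If \<open>B j\<close> is the sum of the \<open>j\<close> largest entries of \<open>b\<close>,
  then a partition with partial sums \<open>M\<close> dominates the rearrangement of \<open>b @ [m]\<close> iff \<open>B j \<le> M j\<close> and
  \<open>B j + m \<le> M (j + 1)\<close> for all \<open>j\<close>. The entries equal to \<open>p + 1\<close> of a semistandard tableau form a
  horizontal strip of size \<open>m = a\<^sub>p\<^sub>+\<^sub>1\<close> whose removal leaves a shape with partial sums \<open>N \<ge> B\<close>;
  call such \<open>N\<close> feasible if moreover no box above the prescribed row is removed.

  Existence: if row \<open>l\<close> has length at least \<open>m\<close>, removing the lowest box of each of the first \<open>m\<close>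
  columns is feasible from row \<open>l\<close>. Minimality: the top row of any feasible strip lies in
  \<open>R(\<mu>, a)\<close>, so the greedy row \<open>l'\<close> is at most that row; if \<open>M'\<close> is \<open>M\<close> after the greedy removal,
  then the pointwise minimum of \<open>N\<close> and \<open>M'\<close> is feasible for \<open>M'\<close> and \<open>m - 1\<close>. Iterating \<open>m\<close> times
  leaves strips of size 0, whence the greedy shape has partial sums below every feasible \<open>N\<close>.
  Comparing a tableau with the greedy one at the largest \<open>p\<close> where the shapes of the entries \<open>\<le> p\<close>
  differ gives the theorem.
\<close>

section \<open>Partial sums and dominance\<close>

text \<open>Constant past the end of the list, so that sequences of different heights can be
  compared as functions on \<open>nat\<close>.\<close>

definition psum :: "nat list \<Rightarrow> nat \<Rightarrow> nat" where
  "psum c j = sum_list (take j c)"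

lemma psum_0 [simp]: "psum c 0 = 0"
  by (simp add: psum_def)

lemma part_0 [simp]: "part c 0 = 0"
  by (simp add: part_def)

lemma part_beyond: "length c < i \<Longrightarrow> part c i = 0"
  by (simp add: part_def)

lemma psum_Suc: "psum c (Suc j) = psum c j + part c (Suc j)"
  by (cases "j < length c") (auto simp: psum_def part_def take_Suc_conv_app_nth)

lemma psum_beyond: "length c \<le> j \<Longrightarrow> psum c j = sum_list c"
  by (simp add: psum_def)

lemma psum_eq_sum_part: "psum c j = (\<Sum>i=1..j. part c i)"
  by (induction j) (auto simp: psum_Suc)

lemma psum_mono: "i \<le> j \<Longrightarrow> psum c i \<le> psum c j"
  by (rule lift_Suc_mono_le[of "psum c"]) (auto simp: psum_Suc)

lemma psum_le_sum_list: "psum c j \<le> sum_list c"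
  by (metis psum_beyond psum_mono nat_le_linear)

lemma part_pos:
  assumes "\<forall>x\<in>set c. 0 < x" "1 \<le> i" "i \<le> length c"
  shows "0 < part c i"
  using assms by (auto simp: part_def)

text \<open>The height condition comes for free: if \<open>d\<close> were shorter than
  \<open>c\<close>, then \<open>psum c\<close> would still grow past \<open>length d\<close> by a
  positive entry, while \<open>psum d\<close> has already reached the common total.\<close>

lemma dominates_iff_psum:
  assumes "\<forall>x\<in>set c. 0 < x" "sum_list c = sum_list d"
  shows "c \<unrhd> d \<longleftrightarrow> (\<forall>j. psum d j \<le> psum c j)"
proof
  assume L: "c \<unrhd> d"
  show "\<forall>j. psum d j \<le> psum c j"
  proof
    fix j
    consider "j = 0" | "j \<in> {1..length c}" | "length c \<le> j"
      by fastforce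
    then show "psum d j \<le> psum c j"
    proof cases
      case 3
      then show ?thesis using assms(2) psum_le_sum_list[of d j] by (simp add: psum_beyond)
    qed (use L in \<open>auto simp: dominates_def psum_def\<close>)
  qed
next
  assume R: "\<forall>j. psum d j \<le> psum c j"
  have "length c \<le> length d"
  proof (rule ccontr)
    assume "\<not> length c \<le> length d"
    then have lt: "Suc (length d) \<le> length c" by simp
    then have "psum c (length d) < psum c (Suc (length d))"
      using part_pos[OF assms(1)] by (auto simp: psum_Suc)
    also have "\<dots> \<le> sum_list c" by (rule psum_le_sum_list)
    also have "\<dots> = psum d (length d)" using assms(2) by (simp add: psum_beyond)
    finally show False using R by (metis not_le)
  qed
  then show "c \<unrhd> d" using R by (auto simp: dominates_def psum_def)
qed

section \<open>Trailing zeros, partitions, and removal of a box\<close>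

lemma strip_zeros_append: "\<exists>k. c = strip_zeros c @ replicate k 0"
proof -
  let ?P = "\<lambda>x::nat. x = 0"
  have "takeWhile ?P (rev c) = replicate (length (takeWhile ?P (rev c))) 0"
    by (metis (full_types) replicate_length_same set_takeWhileD)
  then have "c = strip_zeros c @ replicate (length (takeWhile ?P (rev c))) 0"
    unfolding strip_zeros_def
    by (metis rev_append rev_replicate rev_rev_ident takeWhile_dropWhile_id)
  then show ?thesis ..
qed

lemma part_strip_zeros: "part (strip_zeros c) i = part c i"
proof -
  obtain k where "c = strip_zeros c @ replicate k 0" using strip_zeros_append by blast
  then have "part c i = part (strip_zeros c @ replicate k 0) i" by simp
  then show ?thesis by (auto simp: part_def nth_append)
qed

lemma length_strip_zeros_le: "length (strip_zeros c) \<le> length c"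
  by (metis length_append le_add1 strip_zeros_append)

lemma psum_strip_zeros: "psum (strip_zeros c) j = psum c j"
  by (simp add: psum_eq_sum_part part_strip_zeros)

lemma sum_list_strip_zeros: "sum_list (strip_zeros c) = sum_list c"
  by (metis psum_strip_zeros psum_beyond nat_le_linear)

lemma last_strip_zeros: "strip_zeros c \<noteq> [] \<Longrightarrow> last (strip_zeros c) \<noteq> 0"
  unfolding strip_zeros_def
  by (metis (mono_tags, lifting) hd_dropWhile last_rev rev_is_Nil_conv)

lemma part_antimono:
  assumes "\<And>i. 1 \<le> i \<Longrightarrow> part c (Suc i) \<le> part c i" "1 \<le> i" "i \<le> j"
  shows "part c j \<le> part c i"
  using assms(3)
proof (induction j rule: dec_induct)
  case (step j)
  then show ?case using assms(1)[of j] assms(2) by simp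
qed simp

lemma is_partition_strip_zeros:
  assumes "\<And>i. 1 \<le> i \<Longrightarrow> part c (Suc i) \<le> part c i"
  shows "is_partition (sum_list c) (strip_zeros c)"
proof -
  let ?d = "strip_zeros c"
  have anti: "?d ! j \<le> ?d ! i" if "i \<le> j" "j < length ?d" for i j
  proof -
    have "part ?d (Suc j) \<le> part ?d (Suc i)"
      using part_antimono[of c "Suc i" "Suc j"] assms that by (simp add: part_strip_zeros)
    then show ?thesis using that by (simp add: part_def)
  qed
  have "0 < x" if x: "x \<in> set ?d" for x
  proof -
    obtain i where i: "i < length ?d" "?d ! i = x" using x by (metis in_set_conv_nth)
    have "?d ! (length ?d - 1) \<le> ?d ! i" using i(1) by (intro anti) auto
    moreover have "?d \<noteq> []" using x by auto
    ultimately show ?thesis using last_strip_zeros[of c] i(2) by (simp add: last_conv_nth)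
  qed
  then show ?thesis
    unfolding is_partition_def is_composition_def
    using anti by (auto simp: sum_list_strip_zeros sorted_wrt_iff_nth_less)
qed

lemma partition_part_antimono:
  assumes "is_partition n c" "1 \<le> i" "i \<le> j"
  shows "part c j \<le> part c i"
  using assms
  by (cases "i = j")
     (auto simp: part_def is_partition_def sorted_wrt_iff_nth_less)

lemma positive_list_eqI:
  assumes "\<forall>x\<in>set c. 0 < x" "\<forall>x\<in>set d. 0 < x" "\<And>i. part c i = part d i"
  shows "c = d"
proof -
  have "length c \<le> length d" if "\<forall>x\<in>set c. 0 < x" "\<And>i. part c i = part d i"
    for c d :: "nat list"
    using part_pos[OF that(1), of "length c"] that(2)[of "length c"] part_beyond[of d "length c"]
    by (cases "length c") (auto simp: not_less_eq_eq[symmetric])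
  from this[of c d] this[of d c] have len: "length c = length d" using assms by simp
  have "c ! i = d ! i" if "i < length c" for i
    using assms(3)[of "Suc i"] that len by (auto simp: part_def)
  then show ?thesis using len by (simp add: nth_equalityI)
qed

lemma part_list_update_dec:
  assumes "1 \<le> i" "i \<le> length c"
  shows "part (c[i - 1 := c ! (i - 1) - 1]) j = part c j - (if j = i then 1 else 0)"
  using assms by (auto simp: part_def nth_list_update)

lemma part_dec_part:
  assumes "1 \<le> i" "i \<le> length c"
  shows "part (dec_part c i) j = part c j - (if j = i then 1 else 0)"
  using part_list_update_dec[OF assms] by (simp add: dec_part_def part_strip_zeros)

text \<open>The additive form with \<open>of_bool\<close> keeps truncated subtraction out of the
  later linear arithmetic.\<close>

lemma psum_dec_part:
  assumes "1 \<le> i" "i \<le> length c" "0 < part c i"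
  shows "psum (dec_part c i) j + of_bool (i \<le> j) = psum c j"
proof (induction j)
  case 0
  then show ?case using assms by simp
next
  case (Suc j)
  then show ?case using assms part_dec_part[OF assms(1,2), of "Suc j"]
    by (auto simp: psum_Suc le_Suc_eq)
qed

lemma length_dec_part_le: "length (dec_part c i) \<le> length c"
  unfolding dec_part_def by (metis length_strip_zeros_le length_list_update)

lemma is_partition_dec_part:
  assumes "is_partition n c" "1 \<le> i" "i \<le> length c" "part c (Suc i) < part c i"
  shows "is_partition (n - 1) (dec_part c i)"
proof -
  let ?d = "c[i - 1 := c ! (i - 1) - 1]"
  have "part ?d (Suc j) \<le> part ?d j" if "1 \<le> j" for j
    using partition_part_antimono[OF assms(1) that, of "Suc j"] assms(4)
    unfolding part_list_update_dec[OF assms(2,3)] by auto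
  then have "is_partition (sum_list ?d) (dec_part c i)"
    unfolding dec_part_def by (rule is_partition_strip_zeros)
  moreover have "sum_list ?d = n - 1"
  proof -
    have "sum_list (dec_part c i) + 1 = sum_list c"
      using psum_dec_part[of i c "length c"] assms(2-4) length_dec_part_le[of c i]
      by (simp add: psum_beyond)
    then show ?thesis using assms(1)
      by (simp add: dec_part_def sum_list_strip_zeros is_partition_def is_composition_def)
  qed
  ultimately show ?thesis by simp
qed

section \<open>Sums of the largest entries, the \<open>B\<close> of the overview\<close>

definition tops :: "nat list \<Rightarrow> nat \<Rightarrow> nat" where
  "tops b = psum (nonincr_rearr b)"

lemma tops_0 [simp]: "tops b 0 = 0"
  by (simp add: tops_def)

lemma tops_Nil [simp]: "tops [] j = 0"
  by (simp add: tops_def nonincr_rearr_def psum_def)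

lemma sum_list_nonincr_rearr: "sum_list (nonincr_rearr b) = sum_list b"
  unfolding nonincr_rearr_def by (metis mset_rev mset_sort sum_mset_sum_list)

lemma psum_append_middle:
  "psum (us @ m # vs) (Suc j) =
     (if j < length us then psum us (Suc j) else sum_list us + m + psum vs (j - length us))"
  by (auto simp: psum_def Suc_diff_le)

lemma psum_append:
  "psum (us @ vs) j = (if j \<le> length us then psum us j else sum_list us + psum vs (j - length us))"
  by (auto simp: psum_def)

text \<open>A largest choice of \<open>j + 1\<close> entries either omits \<open>m\<close> or
  consists of \<open>m\<close> and the \<open>j\<close> largest entries of \<open>b\<close>.
  Formally, \<open>m\<close> is inserted behind the entries \<open>us\<close> that are at least
  \<open>m\<close>, and comparing \<open>j\<close> with \<open>length us\<close> decides which
  alternative attains the maximum.\<close>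

lemma tops_snoc: "tops (b @ [m]) (Suc j) = max (tops b (Suc j)) (tops b j + m)"
proof -
  define xs where "xs = nonincr_rearr b"
  define us where "us = takeWhile (\<lambda>x. m \<le> x) xs"
  define vs where "vs = dropWhile (\<lambda>x. m \<le> x) xs"
  have xs: "xs = us @ vs" by (simp add: us_def vs_def)
  have sorted: "sorted_wrt (\<ge>) xs"
    unfolding xs_def nonincr_rearr_def by (simp add: sorted_wrt_rev)
  have us_ge: "\<forall>x\<in>set us. m \<le> x" by (auto simp: us_def dest: set_takeWhileD)
  have vs_le: "\<forall>x\<in>set vs. x \<le> m"
  proof (cases vs)
    case (Cons v vs')
    then have "\<not> m \<le> v" unfolding vs_def by (metis hd_dropWhile list.distinct(1) list.sel(1))
    then show ?thesis using sorted xs Cons by (fastforce simp: sorted_wrt_append)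
  qed simp
  have "sort (b @ [m]) = rev (us @ m # vs)"
  proof (rule properties_for_sort)
    have "mset (us @ vs) = mset b" unfolding xs[symmetric] xs_def nonincr_rearr_def by simp
    then show "mset (rev (us @ m # vs)) = mset (b @ [m])" by (simp add: add.commute)
    show "sorted (rev (us @ m # vs))"
      using sorted us_ge vs_le unfolding xs sorted_wrt_rev
      by (fastforce simp: sorted_wrt_append)
  qed
  then have new: "nonincr_rearr (b @ [m]) = us @ m # vs" by (simp add: nonincr_rearr_def)
  show ?thesis
  proof (cases "j < length us")
    case True
    then have "psum xs (Suc j) = psum us (Suc j)" "m \<le> part us (Suc j)" "psum xs j = psum us j"
      using us_ge by (auto simp: xs psum_append part_def)
    then have "psum us (Suc j) = max (psum xs (Suc j)) (psum xs j + m)"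
      by (simp add: psum_Suc)
    then show ?thesis using True
      by (simp add: tops_def new xs_def[symmetric] psum_append_middle)
  next
    case False
    have "part vs (Suc (j - length us)) \<le> m"
      using vs_le by (auto simp: part_def)
    then have "psum vs (Suc (j - length us)) \<le> psum vs (j - length us) + m"
      by (simp add: psum_Suc)
    moreover have "psum xs (Suc j) = sum_list us + psum vs (Suc (j - length us))"
      using False by (simp add: xs psum_append Suc_diff_le)
    moreover have "psum xs j = sum_list us + psum vs (j - length us)"
      using False by (simp add: xs psum_append psum_beyond)
    ultimately have "psum xs (Suc j) \<le> psum xs j + m" "psum xs j = sum_list us + psum vs (j - length us)"
      by simp_all
    then show ?thesis using False
      by (simp add: tops_def new xs_def[symmetric] psum_append_middle)
  qed
qed

lemma tops_snoc_le_iff: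
  assumes "M 0 = 0"
  shows "(\<forall>j. tops (b @ [m]) j \<le> M j) \<longleftrightarrow> (\<forall>j. tops b j \<le> M j \<and> tops b j + m \<le> M (Suc j))"
proof -
  have "(\<forall>j. tops (b @ [m]) j \<le> M j) \<longleftrightarrow> (\<forall>j. tops (b @ [m]) (Suc j) \<le> M (Suc j))"
    by (metis not0_implies_Suc tops_0 zero_le)
  also have "\<dots> \<longleftrightarrow> (\<forall>j. tops b (Suc j) \<le> M (Suc j)) \<and> (\<forall>j. tops b j + m \<le> M (Suc j))"
    by (auto simp: tops_snoc)
  also have "(\<forall>j. tops b (Suc j) \<le> M (Suc j)) \<longleftrightarrow> (\<forall>j. tops b j \<le> M j)"
    by (metis not0_implies_Suc tops_0 zero_le)
  finally show ?thesis by blast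
qed

text \<open>Gives both cases of \<open>tilde\<close> one form: for \<open>m = 1\<close> the last
  entry disappears, and the second inequality, now with \<open>m - 1 = 0\<close>, follows from the
  first by monotonicity of \<open>M\<close>.\<close>

lemma tops_tilde_le_iff:
  assumes "mono M" "M 0 = 0" "0 < m"
  shows "(\<forall>j. tops (tilde (b @ [m])) j \<le> M j) \<longleftrightarrow>
         (\<forall>j. tops b j \<le> M j \<and> tops b j + (m - 1) \<le> M (Suc j))"
proof (cases "m = 1")
  case True
  have "M j \<le> M (Suc j)" for j using assms(1) by (simp add: monoD)
  then show ?thesis using True by (auto simp: tilde_def intro: order.trans)
next
  case False
  then show ?thesis using assms tops_snoc_le_iff[of M b "m - 1"] by (auto simp: tilde_def)
qed

lemma sum_list_tilde: "0 < m \<Longrightarrow> sum_list (tilde (b @ [m])) = sum_list b + (m - 1)"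
  by (auto simp: tilde_def)

section \<open>Horizontal strips\<close>

text \<open>\<open>M\<close> and \<open>N\<close> are the partial sums of two partitions; the inequalities are the interlacing
  \<open>\<mu>\<^sub>j\<^sub>+\<^sub>2 \<le> \<nu>\<^sub>j\<^sub>+\<^sub>1 \<le> \<mu>\<^sub>j\<^sub>+\<^sub>1\<close>.\<close>

definition strip :: "(nat \<Rightarrow> nat) \<Rightarrow> (nat \<Rightarrow> nat) \<Rightarrow> bool" where
  "strip M N \<longleftrightarrow> N 0 = M 0 \<and>
     (\<forall>j. M (Suc (Suc j)) + N j \<le> M (Suc j) + N (Suc j) \<and> N (Suc j) + M j \<le> M (Suc j) + N j)"

text \<open>\<open>M j - N j\<close> counts the boxes removed from the first \<open>j\<close> rows,
  and each further row loses a nonnegative number of boxes.\<close>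

lemma strip_diff_mono:
  assumes "strip M N" "i \<le> j"
  shows "N j + M i \<le> M j + N i"
  using assms(2)
proof (induction j rule: dec_induct)
  case (step j)
  have "N (Suc j) + M j \<le> M (Suc j) + N j" using assms(1) by (simp add: strip_def)
  with step show ?case by simp
qed simp

lemma strip_le: "strip M N \<Longrightarrow> N j \<le> M j"
  using strip_diff_mono[of M N 0 j] by (simp add: strip_def)

text \<open>In use \<open>K\<close> bounds the number of rows, so the final clause fixes the size
  \<open>m\<close> of the strip. Agreement for \<open>j < l\<close> says that the rows above row
  \<open>l\<close> lose nothing.\<close>

definition feasible ::
  "nat \<Rightarrow> (nat \<Rightarrow> nat) \<Rightarrow> (nat \<Rightarrow> nat) \<Rightarrow> nat \<Rightarrow> nat \<Rightarrow> (nat \<Rightarrow> nat) \<Rightarrow> bool" where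
  "feasible K M B m l N \<longleftrightarrow> strip M N \<and> (\<forall>j<l. N j = M j) \<and> (\<forall>j. B j \<le> N j) \<and>
     (\<forall>j\<ge>K. N j + m = M j)"

text \<open>By interlacing, \<open>M (Suc i) - N i\<close> does not increase with \<open>i\<close>,
  and far out it is at least \<open>M i - N i = m\<close>. Hence
  \<open>N j + m \<le> M (Suc j)\<close> for every \<open>j\<close>, and
  \<open>B j \<le> N j\<close> finishes the second claim.\<close>

lemma strip_dominance:
  assumes "strip M N" "mono M" "\<forall>j\<ge>K. N j + m = M j" "\<forall>j. B j \<le> N j"
  shows "B j \<le> M j" and "B j + m \<le> M (Suc j)"
proof -
  show "B j \<le> M j" using assms(4) strip_le[OF assms(1), of j] by (meson order.trans)
  have antimono: "M (Suc i) + N j \<le> M (Suc j) + N i" if "j \<le> i" for i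
    using that
  proof (induction i rule: dec_induct)
    case (step i)
    have "M (Suc (Suc i)) + N i \<le> M (Suc i) + N (Suc i)" using assms(1) by (simp add: strip_def)
    with step show ?case by simp
  qed simp
  have "M (max j K) \<le> M (Suc (max j K))"
    by (intro monoD[OF assms(2)] le_SucI order_refl)
  moreover have "N (max j K) + m = M (max j K)" using assms(3) by simp
  ultimately show "B j + m \<le> M (Suc j)"
    using antimono[of "max j K"] assms(4)[rule_format, of j] by simp
qed

text \<open>The count \<open>M j - N j\<close> is nondecreasing in \<open>j\<close> and vanishes
  from \<open>K\<close> on.\<close>

lemma feasible_0:
  assumes "feasible K M B 0 l N"
  shows "N j = M j"
proof -
  have "N (max j K) = M (max j K)" "strip M N" using assms by (auto simp: feasible_def)
  then show ?thesis
    using strip_diff_mono[of M N j "max j K"] strip_le[of M N j] by simp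
qed

text \<open>\<open>M'\<close> is \<open>M\<close> with one box less in row \<open>l\<close>. For the
  first strip inequality, if \<open>N\<close> attains the minimum at \<open>Suc j\<close> the bound
  is inherited from \<open>N\<close>; otherwise it is concavity of \<open>M'\<close>. For the
  second, the minimum is \<open>M'\<close> above row \<open>l\<close>, and from \<open>l\<close> on
  \<open>M\<close> and \<open>M'\<close> differ by a constant.\<close>

lemma strip_min:
  assumes "strip M N"
    and concave: "\<And>j. M' (Suc (Suc j)) + M' j \<le> 2 * M' (Suc j)"
    and M': "\<And>j. M' j + of_bool (l \<le> j) = M j"
    and eq: "\<And>j. j < l \<Longrightarrow> N j = M j" and "0 < l"
  shows "strip M' (\<lambda>j. min (N j) (M' j))"
  unfolding strip_def
proof (intro conjI allI)
  show "min (N 0) (M' 0) = M' 0" using M'[of 0] eq[of 0] \<open>0 < l\<close> by simp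
  fix j
  have s: "M (Suc (Suc j)) + N j \<le> M (Suc j) + N (Suc j)" "N (Suc j) + M j \<le> M (Suc j) + N j"
    using assms(1) by (auto simp: strip_def)
  show "M' (Suc (Suc j)) + min (N j) (M' j) \<le> M' (Suc j) + min (N (Suc j)) (M' (Suc j))"
  proof (cases "N (Suc j) \<le> M' (Suc j)")
    case True
    then show ?thesis using s(1) M'[of "Suc (Suc j)"] M'[of "Suc j"]
      by (cases "l \<le> Suc j") auto
  next
    case False
    then show ?thesis using concave[of j] by linarith
  qed
  show "min (N (Suc j)) (M' (Suc j)) + M' j \<le> M' (Suc j) + min (N j) (M' j)"
  proof (cases "j < l")
    case True
    then have "min (N j) (M' j) = M' j" using eq[of j] M'[of j] by simp
    then show ?thesis by simp
  next
    case False
    then show ?thesis using s(2) M'[of j] M'[of "Suc j"] by simp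
  qed
qed

lemma partition_psum_concave:
  assumes "is_partition n c"
  shows "psum c (Suc (Suc j)) + psum c j \<le> 2 * psum c (Suc j)"
  using partition_part_antimono[OF assms, of "Suc j" "Suc (Suc j)"] by (simp add: psum_Suc)

lemma mono_psum: "mono (psum c)"
  by (simp add: monoI psum_mono)

lemma partition_sum_list: "is_partition n c \<Longrightarrow> sum_list c = n"
  by (simp add: is_partition_def is_composition_def)

lemma partition_pos: "is_partition n c \<Longrightarrow> \<forall>x\<in>set c. 0 < x"
  by (simp add: is_partition_def is_composition_def)

lemma dominates_nonincr_rearr_iff:
  assumes "is_partition (sum_list b) c"
  shows "c \<unrhd> nonincr_rearr b \<longleftrightarrow> (\<forall>j. tops b j \<le> psum c j)"
  using assms partition_pos[OF assms] partition_sum_list[OF assms]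
  by (simp add: dominates_iff_psum sum_list_nonincr_rearr tops_def)

lemma R_set_iff:
  assumes "is_partition (sum_list b + m) c" "0 < m"
  shows "i \<in> R_set c (b @ [m]) \<longleftrightarrow>
    1 \<le> i \<and> i \<le> length c \<and> part c (Suc i) < part c i \<and>
    (\<forall>j. tops b j \<le> psum (dec_part c i) j \<and> tops b j + (m - 1) \<le> psum (dec_part c i) (Suc j))"
proof (cases "1 \<le> i \<and> i \<le> length c \<and> part c (Suc i) < part c i")
  case True
  then have "is_partition (sum_list (tilde (b @ [m]))) (dec_part c i)"
    using is_partition_dec_part[OF assms(1), of i] assms(2) by (auto simp: sum_list_tilde)
  from dominates_nonincr_rearr_iff[OF this] True show ?thesis
    using tops_tilde_le_iff[OF mono_psum psum_0 assms(2)] by (simp add: R_set_def)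
qed (auto simp: R_set_def)

text \<open>The row \<open>f\<close> is the first one to lose a box. Its last box is a corner, and
  once that box is gone \<open>N\<close> is still a strip, now of size \<open>m - 1\<close>;
  \<open>strip_dominance\<close> for this smaller strip yields the dominance required for membership
  in \<open>R_set\<close>.\<close>

lemma feasible_first_row:
  assumes part: "is_partition (sum_list b + m) c" and "0 < m"
    and feas: "feasible K (psum c) (tops b) m l N"
  obtains f where "f \<in> R_set_from c (b @ [m]) l" "\<And>j. j < f \<Longrightarrow> N j = psum c j"
proof -
  let ?M = "psum c"
  have strip: "strip ?M N" and low: "\<And>j. j < l \<Longrightarrow> N j = ?M j" and dom: "\<forall>j. tops b j \<le> N j"
    and tot: "\<forall>j\<ge>K. N j + m = ?M j"
    using feas by (auto simp: feasible_def)
  define f where "f = (LEAST j. N j < ?M j)"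
  have "N K < ?M K" using tot \<open>0 < m\<close> by (metis less_add_same_cancel1 order_refl)
  then have f: "N f < ?M f" unfolding f_def by (rule LeastI)
  have below: "N j = ?M j" if "j < f" for j
    using that not_less_Least[of j "\<lambda>j. N j < ?M j"] strip_le[OF strip, of j]
    unfolding f_def by simp
  have "f \<noteq> 0" using f strip by (metis less_irrefl strip_def)
  then obtain g where g: "f = Suc g" by (cases f) auto
  \<comment> \<open>Row \<open>f\<close> keeps at least the length of row \<open>f + 1\<close> but
    loses a box, so it is strictly longer than row \<open>f + 1\<close>.\<close>
  have "?M (Suc f) + N g \<le> ?M f + N f"
    using strip unfolding strip_def g by blast
  moreover have "N g = ?M g" using below[of g] g by simp
  ultimately have corner: "part c (Suc f) < part c f"
    using f by (simp add: g psum_Suc)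
  have len: "f \<le> length c" using corner part_beyond[of c f] by (metis not_less not_less_zero)
  define M' where "M' = psum (dec_part c f)"
  have M': "M' j + of_bool (f \<le> j) = ?M j" for j
    unfolding M'_def using psum_dec_part[of f c j] len corner g by simp
  have "is_partition (sum_list b + m - 1) (dec_part c f)"
    using is_partition_dec_part[OF part, of f] corner len g by simp
  then have conc: "M' (Suc (Suc j)) + M' j \<le> 2 * M' (Suc j)" for j
    unfolding M'_def by (rule partition_psum_concave)
  have "N j \<le> M' j" for j
    using M'[of j] below[of j] strip_diff_mono[OF strip, of f j] f
    by (cases "j < f") auto
  then have "min (N j) (M' j) = N j" for j by simp
  then have strip': "strip M' N"
    using strip_min[OF strip conc M' below] g by simp
  \<comment> \<open>The index must also reach \<open>f\<close>, since only then is the box removed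
    from row \<open>f\<close> counted in \<open>M'\<close>.\<close>
  have tot': "\<forall>j\<ge>max K f. N j + (m - 1) = M' j"
  proof (intro allI impI)
    fix j assume "max K f \<le> j"
    then show "N j + (m - 1) = M' j" using tot M'[of j] \<open>0 < m\<close> by (auto simp: max_def split: if_splits)
  qed
  have "mono M'" unfolding M'_def by (rule mono_psum)
  from strip_dominance[OF strip' this tot' dom]
  have "f \<in> R_set c (b @ [m])"
    using corner len g unfolding R_set_iff[OF part \<open>0 < m\<close>] M'_def by auto
  moreover have "l \<le> f" using f low[of f] by (metis less_irrefl not_less)
  ultimately show thesis using that[of f] below by (simp add: R_set_from_def)
qed

lemma finite_R_set_from: "finite (R_set_from c a l)"
  by (simp add: R_set_from_def R_set_def)

text \<open>The greedy row is at most the top row of the strip of \<open>N\<close>, so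
  \<open>N\<close> is intact above it. The greedy box need not belong to that strip, hence the
  minimum; past \<open>K\<close> the minimum is \<open>N\<close> itself, which leaves
  \<open>m - 1\<close> boxes.\<close>

lemma feasible_step:
  assumes part: "is_partition (sum_list b + m) c" and "0 < m" and "length c \<le> K"
    and feas: "feasible K (psum c) (tops b) m l N"
  defines "l' \<equiv> l_min_from c (b @ [m]) l"
  shows "l' \<in> R_set_from c (b @ [m]) l"
    and "feasible K (psum (dec_part c l')) (tops b) (m - 1) l'
           (\<lambda>j. min (N j) (psum (dec_part c l') j))"
proof -
  obtain f where f: "f \<in> R_set_from c (b @ [m]) l" and below: "\<And>j. j < f \<Longrightarrow> N j = psum c j"
    using feasible_first_row[OF assms(1,2,4)] by blast
  then show l': "l' \<in> R_set_from c (b @ [m]) l"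
    unfolding l'_def l_min_from_def by (intro Min_in finite_R_set_from) auto
  have "l' \<le> f" unfolding l'_def l_min_from_def using f by (intro Min_le finite_R_set_from)
  then have low: "N j = psum c j" if "j < l'" for j using below that by simp
  have R: "1 \<le> l'" "l' \<le> length c" "part c (Suc l') < part c l'"
      "\<And>j. tops b j \<le> psum (dec_part c l') j"
    using l' unfolding R_set_from_def by (auto simp: R_set_iff[OF part \<open>0 < m\<close>])
  have M': "psum (dec_part c l') j + of_bool (l' \<le> j) = psum c j" for j
    using psum_dec_part[of l' c j] R by simp
  have "is_partition (sum_list b + m - 1) (dec_part c l')"
    using is_partition_dec_part[OF part] R by simp
  note concave = partition_psum_concave[OF this]
  have l'_pos: "0 < l'" using R(1) by simp
  have "strip (psum c) N" using feas by (simp add: feasible_def)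
  then have "strip (psum (dec_part c l')) (\<lambda>j. min (N j) (psum (dec_part c l') j))"
    using concave M' low l'_pos by (rule strip_min)
  moreover have "min (N j) (psum (dec_part c l') j) = psum (dec_part c l') j" if "j < l'" for j
    using low[OF that] M'[of j] that by simp
  moreover have "min (N j) (psum (dec_part c l') j) + (m - 1) = psum (dec_part c l') j" if "K \<le> j" for j
  proof -
    have "l' \<le> j" using R(2) assms(3) that by simp
    moreover have "N j + m = psum c j" using feas that by (simp add: feasible_def)
    ultimately show ?thesis using M'[of j] \<open>0 < m\<close> by simp
  qed
  ultimately show "feasible K (psum (dec_part c l')) (tops b) (m - 1) l'
           (\<lambda>j. min (N j) (psum (dec_part c l') j))"
    using R(4) feas by (auto simp: feasible_def)
qed

text \<open>The witness removes the lowest box of each of the first \<open>m\<close> columns: this takes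
  \<open>m - \<mu>\<^sub>j\<^sub>+\<^sub>1\<close> (truncated) boxes from the first \<open>j\<close> rows.\<close>

lemma feasible_exists:
  assumes part: "is_partition n c" and "1 \<le> l" "m \<le> part c l" "length c \<le> K"
    and dom: "\<And>j. tops b j \<le> psum c j" "\<And>j. tops b j + m \<le> psum c (Suc j)"
  shows "\<exists>N. feasible K (psum c) (tops b) m l N"
proof
  let ?N = "\<lambda>j. psum c j - (m - part c (Suc j))"
  \<comment> \<open>Never more boxes are removed than are present, so the outer subtraction in
    \<open>?N\<close> is exact.\<close>
  have ge: "m - part c (Suc j) \<le> psum c j" for j
    using dom(2)[of j] by (simp add: psum_Suc)
  have anti: "part c (Suc (Suc j)) \<le> part c (Suc j)" for j
    using partition_part_antimono[OF part] by simp
  show "feasible K (psum c) (tops b) m l ?N"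
    unfolding feasible_def strip_def
  proof (intro conjI allI impI)
    fix j
    show "psum c (Suc (Suc j)) + ?N j \<le> psum c (Suc j) + ?N (Suc j)"
      using anti[of j] ge[of j] ge[of "Suc j"] by (simp add: psum_Suc)
    show "?N (Suc j) + psum c j \<le> psum c (Suc j) + ?N j"
      using anti[of j] ge[of j] ge[of "Suc j"] by (simp add: psum_Suc)
    show "tops b j \<le> ?N j"
      using dom(1)[of j] dom(2)[of j] by (simp add: psum_Suc)
  next
    fix j assume "j < l"
    then have "m \<le> part c (Suc j)"
      using partition_part_antimono[OF part, of "Suc j" l] assms(3) by simp
    then show "?N j = psum c j" by simp
  next
    fix j assume "K \<le> j"
    then show "?N j + m = psum c j"
      using ge[of j] assms(4) by (simp add: part_beyond)
  qed simp
qed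

section \<open>Greedy removal of a strip\<close>

text \<open>The hypothesis \<open>intact\<close> says that all \<open>i\<close> boxes removed so far
  lie in the first \<open>l'\<close> rows, so row \<open>l' + 1\<close> still has its original
  length. As row \<open>l'\<close> is currently longer than that, it can lose a box without breaking
  the interlacing with the original shape.\<close>

lemma strip_remove_below:
  assumes "strip M0 M" and M': "\<And>j. M' j + of_bool (l' \<le> j) = M j"
    and "0 < l'" and intact: "\<And>j. l' \<le> j \<Longrightarrow> M j + i = M0 j"
    and corner: "M (Suc l') + M (l' - 1) < 2 * M l'"
  shows "strip M0 M'"
  unfolding strip_def
proof (intro conjI allI)
  show "M' 0 = M0 0" using M'[of 0] \<open>0 < l'\<close> assms(1) by (simp add: strip_def)
  fix j
  have s: "M0 (Suc (Suc j)) + M j \<le> M0 (Suc j) + M (Suc j)" "M (Suc j) + M0 j \<le> M0 (Suc j) + M j"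
    using assms(1) by (auto simp: strip_def)
  show "M' (Suc j) + M0 j \<le> M0 (Suc j) + M' j"
    using s(2) M'[of j] M'[of "Suc j"] by (cases "l' \<le> j") auto
  show "M0 (Suc (Suc j)) + M' j \<le> M0 (Suc j) + M' (Suc j)"
  proof (cases "l' = Suc j")
    case True
    then show ?thesis
      using corner intact[of "Suc j"] intact[of "Suc (Suc j)"] M'[of j] M'[of "Suc j"] by simp
  next
    case False
    then show ?thesis using s(1) M'[of j] M'[of "Suc j"] by (cases "l' \<le> j") auto
  qed
qed

text \<open>Loop invariant for removing the \<open>m\<close> boxes of one entry. Confinement of the
  removed boxes to the first \<open>l i\<close> rows keeps the result a strip. Every feasible
  \<open>N\<close> is carried along: the one from \<open>feasible_exists\<close> shows that the next
  minimum is over a nonempty set, and arbitrary ones serve minimality.\<close>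

lemma greedy_block:
  fixes c :: "nat \<Rightarrow> nat list" and l :: "nat \<Rightarrow> nat"
  assumes part0: "is_partition (sum_list b + m) (c 0)" and len0: "length (c 0) \<le> K"
    and l0: "1 \<le> l 0" "m \<le> part (c 0) (l 0)"
    and dom: "\<And>j. tops b j \<le> psum (c 0) j" "\<And>j. tops b j + m \<le> psum (c 0) (Suc j)"
    and l_Suc: "\<And>i. i < m \<Longrightarrow> l (Suc i) = l_min_from (c i) (b @ [m - i]) (l i)"
    and c_Suc: "\<And>i. i < m \<Longrightarrow> c (Suc i) = dec_part (c i) (l (Suc i))"
    and "i \<le> m"
  shows "(is_partition (sum_list b + (m - i)) (c i) \<and> length (c i) \<le> K \<and>
    strip (psum (c 0)) (psum (c i)) \<and> (\<forall>j\<ge>l i. psum (c i) j + i = psum (c 0) j) \<and>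
    l 0 \<le> l i \<and> (\<forall>j<l 0. psum (c i) j = psum (c 0) j) \<and>
    (\<forall>N. feasible K (psum (c 0)) (tops b) m (l 0) N \<longrightarrow>
       feasible K (psum (c i)) (tops b) (m - i) (l i) (\<lambda>j. min (N j) (psum (c i) j)))) \<and>
    (i < m \<longrightarrow> l (Suc i) \<in> R_set_from (c i) (b @ [m - i]) (l i))"
    (is "?P i \<and> _")
proof -
  obtain N0 where N0: "feasible K (psum (c 0)) (tops b) m (l 0) N0"
    using feasible_exists[OF part0 l0 len0 dom] by blast
  have member: "l (Suc i) \<in> R_set_from (c i) (b @ [m - i]) (l i)" if P: "?P i" and "i < m" for i
    unfolding l_Suc[OF \<open>i < m\<close>]
    by (rule feasible_step(1)[where K = K and N = "\<lambda>j. min (N0 j) (psum (c i) j)"])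
       (use P N0 \<open>i < m\<close> in auto)
  have "?P i" using \<open>i \<le> m\<close>
  proof (induction i)
    case 0
    have "min (N j) (psum (c 0) j) = N j" if "feasible K (psum (c 0)) (tops b) m (l 0) N" for N j
      using that strip_le[of "psum (c 0)" N j] by (simp add: feasible_def)
    moreover have "strip (psum (c 0)) (psum (c 0))"
      using partition_psum_concave[OF part0] by (simp add: strip_def mult_2)
    ultimately show ?case using part0 len0 by simp
  next
    case (Suc i)
    then have "i < m" and P: "?P i" by auto
    let ?Init = "psum (c 0)" and ?M = "psum (c i)" and ?M' = "psum (c (Suc i))" and ?l = "l (Suc i)"
    have part_i: "is_partition (sum_list b + (m - i)) (c i)" and mi: "0 < m - i"
      using P \<open>i < m\<close> by auto
    have "?l \<in> R_set (c i) (b @ [m - i])"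
      using member[OF P \<open>i < m\<close>] by (simp add: R_set_from_def)
    then have R: "1 \<le> ?l" "?l \<le> length (c i)" "part (c i) (Suc ?l) < part (c i) ?l"
      using R_set_iff[OF part_i mi, of ?l] by auto
    have l_le: "l i \<le> ?l" using member[OF P \<open>i < m\<close>] by (simp add: R_set_from_def)
    have M': "?M' j + of_bool (?l \<le> j) = ?M j" for j
      unfolding c_Suc[OF \<open>i < m\<close>] using psum_dec_part[of ?l "c i" j] R by simp
    have "is_partition (sum_list b + (m - i) - 1) (c (Suc i))"
      unfolding c_Suc[OF \<open>i < m\<close>] by (rule is_partition_dec_part[OF part_i R])
    then have "is_partition (sum_list b + (m - Suc i)) (c (Suc i))"
      using \<open>i < m\<close> by simp
    moreover have "length (c (Suc i)) \<le> K"
      using P length_dec_part_le[of "c i" ?l] by (auto simp: c_Suc[OF \<open>i < m\<close>])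
    moreover have "strip ?Init ?M'"
    proof (rule strip_remove_below[where M = ?M and l' = ?l and i = i])
      show "?M' j + of_bool (?l \<le> j) = ?M j" for j by (rule M')
      show "strip ?Init ?M" "0 < ?l" using P R(1) by auto
      show "?M j + i = ?Init j" if "?l \<le> j" for j using P l_le that by auto
      show "?M (Suc ?l) + ?M (?l - 1) < 2 * ?M ?l"
        using R(1,3) by (cases ?l) (auto simp: psum_Suc)
    qed
    moreover have "\<forall>j\<ge>?l. ?M' j + Suc i = ?Init j"
    proof (intro allI impI)
      fix j assume "?l \<le> j"
      then have "?M j + i = ?Init j" using P l_le by auto
      then show "?M' j + Suc i = ?Init j" using M'[of j] \<open>?l \<le> j\<close> by simp
    qed
    moreover have "l 0 \<le> ?l" using P l_le by auto
    moreover have "\<forall>j<l 0. ?M' j = ?Init j"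
    proof (intro allI impI)
      fix j assume "j < l 0"
      then have "?M j = ?Init j" "j < ?l" using P l_le by auto
      then show "?M' j = ?Init j" using M'[of j] by simp
    qed
    moreover have "feasible K ?M' (tops b) (m - Suc i) ?l (\<lambda>j. min (N j) (?M' j))"
      if "feasible K ?Init (tops b) m (l 0) N" for N
    proof -
      have feas: "feasible K ?M (tops b) (m - i) (l i) (\<lambda>j. min (N j) (?M j))"
        using P that by blast
      have "length (c i) \<le> K" using P by blast
      from feasible_step(2)[OF part_i mi this feas]
      have "feasible K ?M' (tops b) (m - i - 1) ?l (\<lambda>j. min (min (N j) (?M j)) (?M' j))"
        by (simp only: l_Suc[OF \<open>i < m\<close>, symmetric] c_Suc[OF \<open>i < m\<close>, symmetric])
      moreover have "min (min (N j) (?M j)) (?M' j) = min (N j) (?M' j)" for j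
        using M'[of j] by simp
      ultimately show ?thesis by simp
    qed
    ultimately show ?case by blast
  qed
  then show ?thesis using member by blast
qed

text \<open>At \<open>i = m\<close> the remaining strip has size 0, so
  \<open>min (N j) (psum (c m) j)\<close> equals \<open>psum (c m) j\<close>. Dominance follows by
  taking the witness of \<open>feasible_exists\<close> for \<open>N\<close>.\<close>

lemma greedy_block_end:
  fixes c :: "nat \<Rightarrow> nat list" and l :: "nat \<Rightarrow> nat"
  assumes "is_partition (sum_list b + m) (c 0)" "length (c 0) \<le> K"
    and "1 \<le> l 0" "m \<le> part (c 0) (l 0)"
    and "\<And>j. tops b j \<le> psum (c 0) j" "\<And>j. tops b j + m \<le> psum (c 0) (Suc j)"
    and "\<And>i. i < m \<Longrightarrow> l (Suc i) = l_min_from (c i) (b @ [m - i]) (l i)"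
    and "\<And>i. i < m \<Longrightarrow> c (Suc i) = dec_part (c i) (l (Suc i))"
  shows "\<And>j. tops b j \<le> psum (c m) j"
    and "\<And>N j. feasible K (psum (c 0)) (tops b) m (l 0) N \<Longrightarrow> psum (c m) j \<le> N j"
proof -
  have min: "feasible K (psum (c m)) (tops b) 0 (l m) (\<lambda>j. min (N j) (psum (c m) j))"
    if "feasible K (psum (c 0)) (tops b) m (l 0) N" for N
    using greedy_block[OF assms order_refl] that by (metis diff_self_eq_0)
  then show "psum (c m) j \<le> N j" if "feasible K (psum (c 0)) (tops b) m (l 0) N" for N j
    using feasible_0[OF min[OF that], of j] by linarith
  obtain N0 where "feasible K (psum (c 0)) (tops b) m (l 0) N0"
    using feasible_exists[OF assms(1,3,4,2,5,6)] by blast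
  from min[OF this] show "tops b j \<le> psum (c m) j" for j
    unfolding feasible_def by (meson min.boundedE)
qed

section \<open>The sequences of the construction\<close>

lemma tilde_funpow:
  assumes "0 < m"
  shows "i < m \<Longrightarrow> (tilde ^^ i) (b @ [m]) = b @ [m - i]" and "(tilde ^^ m) (b @ [m]) = b"
proof -
  show *: "(tilde ^^ i) (b @ [m]) = b @ [m - i]" if "i < m" for i
    using that by (induction i) (auto simp: tilde_def)
  have "(tilde ^^ m) (b @ [m]) = tilde ((tilde ^^ (m - 1)) (b @ [m]))"
    using assms by (cases m) auto
  then show "(tilde ^^ m) (b @ [m]) = b" using *[of "m - 1"] assms by (simp add: tilde_def)
qed

lemma sum_list_drop_nth: "p < length a \<Longrightarrow> sum_list (drop p a) = a ! p + sum_list (drop (Suc p) a)"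
  for a :: "nat list"
  by (metis Cons_nth_drop_Suc sum_list.Cons)

lemma sum_list_take_nth: "p < length a \<Longrightarrow> sum_list (take (Suc p) a) = sum_list (take p a) + a ! p"
  for a :: "nat list"
  by (simp add: take_Suc_conv_app_nth)

text \<open>Entries are consumed from the right, and an entry of value \<open>m\<close> takes
  exactly \<open>m\<close> applications of \<open>tilde\<close>; hence the descending induction on
  \<open>p\<close>.\<close>

lemma a_seq_drop:
  assumes pos: "\<forall>x\<in>set a. 0 < x" and "p \<le> length a"
  shows "a_seq a (sum_list (drop p a)) = take p a"
  using assms(2)
proof (induction p rule: inc_induct)
  case base
  then show ?case by (simp add: a_seq_def)
next
  case (step p)
  have "a_seq a (sum_list (drop p a)) = (tilde ^^ (a ! p)) (a_seq a (sum_list (drop (Suc p) a)))"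
    using step by (simp add: a_seq_def sum_list_drop_nth funpow_add)
  also have "\<dots> = (tilde ^^ (a ! p)) (take p a @ [a ! p])"
    using step by (simp add: take_Suc_conv_app_nth)
  also have "\<dots> = take p a"
    by (rule tilde_funpow) (use pos step in auto)
  finally show ?case .
qed

lemma a_seq_block:
  assumes pos: "\<forall>x\<in>set a. 0 < x" and "p < length a" "i < a ! p"
  shows "a_seq a (sum_list (drop (Suc p) a) + i) = take p a @ [a ! p - i]"
proof -
  have "a_seq a (sum_list (drop (Suc p) a) + i) = (tilde ^^ i) (a_seq a (sum_list (drop (Suc p) a)))"
    by (simp add: a_seq_def funpow_add add.commute[of _ i])
  also have "\<dots> = (tilde ^^ i) (take p a @ [a ! p])"
    using assms by (simp add: a_seq_drop take_Suc_conv_app_nth)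
  also have "\<dots> = take p a @ [a ! p - i]"
    by (rule tilde_funpow) (use assms in auto)
  finally show ?thesis .
qed

lemma sum_part_drop:
  assumes "p \<le> length a"
  shows "(\<Sum>j=Suc p..length a. part a j) = sum_list (drop p a)"
  using assms
proof (induction p rule: inc_induct)
  case (step p)
  then have "(\<Sum>j=Suc p..length a. part a j) = part a (Suc p) + (\<Sum>j=Suc (Suc p)..length a. part a j)"
    by (intro sum.atLeast_Suc_atMost) simp
  then show ?case using step by (simp add: sum_list_drop_nth part_def)
qed simp

lemma A_set_eq: "A_set a = {sum_list (drop p a) | p. 1 \<le> p \<and> p < length a}"
proof -
  have "x \<in> A_set a \<longleftrightarrow> (\<exists>p. x = sum_list (drop p a) \<and> 1 \<le> p \<and> p < length a)" for x
  proof
    assume "x \<in> A_set a"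
    then obtain m where m: "x = (\<Sum>j=m..length a. part a j)" "2 \<le> m" "m \<le> length a"
      by (auto simp: A_set_def)
    then show "\<exists>p. x = sum_list (drop p a) \<and> 1 \<le> p \<and> p < length a"
      using sum_part_drop[of "m - 1" a] by (intro exI[of _ "m - 1"]) auto
  next
    assume "\<exists>p. x = sum_list (drop p a) \<and> 1 \<le> p \<and> p < length a"
    then obtain p where p: "x = sum_list (drop p a)" "1 \<le> p" "p < length a" by blast
    then have "x = (\<Sum>j=Suc p..length a. part a j)" using sum_part_drop[of p a] by simp
    then show "x \<in> A_set a" unfolding A_set_def using p by fastforce
  qed
  then show ?thesis by blast
qed

lemma sum_list_drop_antimono: "p \<le> p' \<Longrightarrow> sum_list (drop p' a) \<le> sum_list (drop p a)"
  for a :: "nat list"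
proof -
  assume "p \<le> p'"
  have "drop p' a = drop (p' - p) (drop p a)" using \<open>p \<le> p'\<close> by simp
  then show ?thesis by (metis append_take_drop_id le_add2 sum_list_append)
qed

lemma sum_list_drop_strict:
  fixes a :: "nat list"
  assumes pos: "\<forall>x\<in>set a. 0 < x" and "p < p'" "p < length a"
  shows "sum_list (drop p' a) < sum_list (drop p a)"
proof -
  have "sum_list (drop p' a) \<le> sum_list (drop (Suc p) a)"
    using assms(2) by (intro sum_list_drop_antimono) simp
  moreover have "0 < a ! p" using pos assms(3) by simp
  ultimately show ?thesis using assms(3) by (simp add: sum_list_drop_nth)
qed

text \<open>Tail sums strictly decrease, so \<open>A_set\<close> meets a block only at its first
  step. The block of the last entry starts at step 0, which is not in \<open>A_set\<close>; there
  the row stays at the prescribed \<open>r\<close>.\<close>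

lemma block_mem_A_set:
  assumes pos: "\<forall>x\<in>set a. 0 < x" and "p < length a" "i < a ! p"
  shows "sum_list (drop (Suc p) a) + i \<in> A_set a \<longleftrightarrow> i = 0 \<and> Suc p < length a"
proof
  assume "sum_list (drop (Suc p) a) + i \<in> A_set a"
  then obtain p' where p': "sum_list (drop (Suc p) a) + i = sum_list (drop p' a)" "p' < length a"
    by (auto simp: A_set_eq)
  have "\<not> p' \<le> p"
    using sum_list_drop_antimono[of p' p a] p'(1) assms(2,3) by (auto simp: sum_list_drop_nth)
  moreover have "\<not> Suc p < p'"
    using sum_list_drop_strict[OF pos, of "Suc p" p'] p' by auto
  ultimately have "p' = Suc p" by simp
  then show "i = 0 \<and> Suc p < length a" using p' by simp
next
  assume "i = 0 \<and> Suc p < length a"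
  then show "sum_list (drop (Suc p) a) + i \<in> A_set a" by (auto simp: A_set_eq)
qed

lemma block_exists:
  fixes a :: "nat list"
  assumes "i < sum_list a"
  obtains p i' where "p < length a" "i' < a ! p" "i = sum_list (drop (Suc p) a) + i'"
proof -
  have "\<exists>p<length a. \<exists>i'<a ! p. i = sum_list (drop (Suc p) a) + i'"
    if "p \<le> length a" "i < sum_list (drop p a)" for p
    using that
  proof (induction p rule: inc_induct)
    case (step p)
    show ?case
    proof (cases "i < sum_list (drop (Suc p) a)")
      case False
      then have "i - sum_list (drop (Suc p) a) < a ! p" "i = sum_list (drop (Suc p) a) + (i - sum_list (drop (Suc p) a))"
        using step by (auto simp: sum_list_drop_nth)
      then show ?thesis using step by blast
    qed (use step in blast)
  qed simp
  from this[of 0] show thesis using assms that by auto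
qed

section \<open>The greedy construction, block by block\<close>

locale greedy_setup =
  fixes n r :: nat and \<mu> a :: "nat list"
  assumes mu: "is_partition n \<mu>" and a: "is_composition n a"
    and dom: "\<mu> \<unrhd> nonincr_rearr a"
    and r: "r \<in> R_set \<mu> a" and r_le: "r \<le> s_index \<mu> a"
begin

text \<open>The boxes with entry greater than \<open>p\<close> are those removed in the first \<open>q p\<close> steps, so that
  \<open>shape p\<close> is the shape formed by the entries \<open>\<le> p\<close>.\<close>

definition q :: "nat \<Rightarrow> nat" where "q p = sum_list (drop p a)"

definition shape :: "nat \<Rightarrow> nat list" where "shape p = mu_seq \<mu> a r (q p)"

text \<open>Blocks are processed with \<open>p\<close> descending, so
  \<open>Suc p = length a\<close> marks the first block; each later one is reset to row 1 through
  \<open>A_set\<close>.\<close>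

definition start_row :: "nat \<Rightarrow> nat" where "start_row p = (if Suc p = length a then r else 1)"

lemma a_pos: "\<forall>x\<in>set a. 0 < x" and sum_a: "sum_list a = n"
  using a by (auto simp: is_composition_def)

lemma nth_a_pos: "p < length a \<Longrightarrow> 0 < a ! p"
  using a_pos by simp

lemma tops_a_le: "tops a j \<le> psum \<mu> j"
  using dom dominates_nonincr_rearr_iff[of a \<mu>] mu sum_a by simp

lemma r_bounds: "1 \<le> r" "r \<le> length \<mu>"
  using r by (auto simp: R_set_def)

lemma a_ne: "a \<noteq> []"
proof
  assume "a = []"
  then have "\<mu> = []" using mu sum_a partition_pos[OF mu] partition_sum_list[OF mu]
    by (cases \<mu>) auto
  then show False using r_bounds by simp
qed

lemma a_snoc: "a = take (length a - 1) a @ [a ! (length a - 1)]"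
  by (metis a_ne append_butlast_last_id butlast_conv_take last_conv_nth)

text \<open>The place where \<open>r \<le> s_index \<mu> a\<close> enters: it supplies the row
  length that \<open>feasible_exists\<close> needs in the first block. Dominance gives
  \<open>last a \<le> part \<mu> 1\<close>, so the maximum defining \<open>s_index\<close> is over a
  nonempty set.\<close>

lemma last_le_part_r: "last a \<le> part \<mu> r"
proof -
  let ?X = "{i \<in> {1..length \<mu>}. part \<mu> i \<ge> last a}"
  have "last a \<le> tops a 1"
    using tops_snoc[of "butlast a" "last a" 0] a_ne by simp
  also have "\<dots> \<le> part \<mu> 1" using tops_a_le[of 1] by (simp add: psum_Suc)
  finally have "1 \<in> ?X" using r_bounds by simp
  then have "Max ?X \<in> ?X" by (intro Max_in) auto
  then have "last a \<le> part \<mu> (s_index \<mu> a)" by (simp add: s_index_def)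
  also have "\<dots> \<le> part \<mu> r" using partition_part_antimono[OF mu r_bounds(1) r_le] .
  finally show ?thesis .
qed

lemma q_Suc: "p < length a \<Longrightarrow> q p = q (Suc p) + a ! p"
  by (simp add: q_def sum_list_drop_nth)

lemma q_length [simp]: "q (length a) = 0"
  by (simp add: q_def)

lemma shape_length [simp]: "shape (length a) = \<mu>"
  by (simp add: shape_def)

lemma l_seq_block:
  assumes "p < length a" "i < a ! p"
  shows "l_seq \<mu> a r (Suc (q (Suc p) + i)) =
    l_min_from (mu_seq \<mu> a r (q (Suc p) + i)) (take p a @ [a ! p - i])
      (if i = 0 then start_row p else l_seq \<mu> a r (q (Suc p) + i))"
proof -
  have "q (Suc p) + i = 0" if "i = 0" "\<not> Suc p < length a"
    using that by (simp add: q_def)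
  then show ?thesis
    using block_mem_A_set[OF a_pos assms] a_seq_block[OF a_pos assms] assms(1)
    by (auto simp: q_def[symmetric] start_row_def)
qed

text \<open>The invariant between blocks: what the next block requires of its initial shape.\<close>

definition good :: "nat \<Rightarrow> bool" where
  "good p \<longleftrightarrow> is_partition (sum_list (take p a)) (shape p) \<and> length (shape p) \<le> length \<mu> \<and>
     (\<forall>j. tops (take p a) j \<le> psum (shape p) j)"

text \<open>The output of one block. The third clause is the minimality used to compare tableaux;
  the last one records each chosen row as a member of its candidate set, which gives
  well-definedness.\<close>

definition block_ok :: "nat \<Rightarrow> bool" where
  "block_ok p \<longleftrightarrow> strip (psum (shape (Suc p))) (psum (shape p)) \<and>
     (\<forall>j<start_row p. psum (shape p) j = psum (shape (Suc p)) j) \<and>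
     (\<forall>N. feasible (length \<mu>) (psum (shape (Suc p))) (tops (take p a)) (a ! p) (start_row p) N \<longrightarrow>
        (\<forall>j. psum (shape p) j \<le> N j)) \<and>
     (\<forall>i<a ! p. is_partition (n - (q (Suc p) + i)) (mu_seq \<mu> a r (q (Suc p) + i)) \<and>
        l_seq \<mu> a r (Suc (q (Suc p) + i)) \<in>
        R_set_from (mu_seq \<mu> a r (q (Suc p) + i)) (a_seq a (q (Suc p) + i))
          (if q (Suc p) + i \<in> A_set a then 1 else l_seq \<mu> a r (q (Suc p) + i)))"

lemma n_minus_q: "p \<le> length a \<Longrightarrow> n - q p = sum_list (take p a)"
  unfolding q_def sum_a[symmetric]
  by (metis add_diff_cancel_right' append_take_drop_id sum_list_append)

lemma q_le_n: "q p \<le> n"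
  unfolding q_def sum_a[symmetric] using sum_list_drop_antimono[of 0 p a] by simp

lemma good_step:
  assumes p: "p < length a" and good: "good (Suc p)"
  shows "good p" and "block_ok p"
proof -
  let ?q = "q (Suc p)" and ?b = "take p a" and ?m = "a ! p"
  define c where "c i = mu_seq \<mu> a r (?q + i)" for i
  \<comment> \<open>Index 0 is overridden because a block does not continue from the last row of the
    preceding one.\<close>
  define l where "l i = (if i = 0 then start_row p else l_seq \<mu> a r (?q + i))" for i
  have c0: "c 0 = shape (Suc p)" and cm: "c ?m = shape p"
    using p by (simp_all add: c_def shape_def q_Suc)
  have l0: "l 0 = start_row p" by (simp add: l_def)
  have part0: "is_partition (sum_list ?b + ?m) (c 0)"
    using good p by (simp add: c0 good_def sum_list_take_nth)
  have len0: "length (c 0) \<le> length \<mu>" using good by (simp add: c0 good_def)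
  have snoc: "take (Suc p) a = ?b @ [?m]" using p by (simp add: take_Suc_conv_app_nth)
  have dom0: "tops ?b j \<le> psum (c 0) j" "tops ?b j + ?m \<le> psum (c 0) (Suc j)" for j
    using good tops_snoc_le_iff[of "psum (c 0)" ?b ?m] by (auto simp: c0 good_def snoc)
  have l0_pos: "1 \<le> l 0" using r_bounds by (simp add: l0 start_row_def)
  \<comment> \<open>In later blocks the start is row 1, and \<open>dom0\<close> at
    \<open>j = 0\<close> already bounds the entry by the first row.\<close>
  have m_le: "?m \<le> part (c 0) (l 0)"
  proof (cases "Suc p = length a")
    case True
    then have "?m = last a" using a_ne by (metis diff_Suc_1 last_conv_nth)
    then show ?thesis using True last_le_part_r by (simp add: c0 l0 start_row_def)
  next
    case False
    then show ?thesis using dom0(2)[of 0] by (simp add: l0 start_row_def psum_Suc)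
  qed
  have l_Suc: "l (Suc i) = l_min_from (c i) (?b @ [?m - i]) (l i)" if "i < ?m" for i
    using l_seq_block[OF p that] by (simp add: l_def c_def)
  have c_Suc: "c (Suc i) = dec_part (c i) (l (Suc i))" if "i < ?m" for i
    by (simp add: c_def l_def)
  note block = greedy_block[OF part0 len0 l0_pos m_le dom0 l_Suc c_Suc]
  note block_end = greedy_block_end[OF part0 len0 l0_pos m_le dom0 l_Suc c_Suc]
  show "good p"
    using block[of ?m] block_end(1) by (simp add: good_def cm)
  have "is_partition (n - (?q + i)) (mu_seq \<mu> a r (?q + i)) \<and>
        l_seq \<mu> a r (Suc (?q + i)) \<in> R_set_from (mu_seq \<mu> a r (?q + i)) (a_seq a (?q + i))
          (if ?q + i \<in> A_set a then 1 else l_seq \<mu> a r (?q + i))" if "i < ?m" for i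
  proof -
    have eff: "(if ?q + i \<in> A_set a then 1 else l_seq \<mu> a r (?q + i)) = l i"
    proof (cases "i = 0 \<and> Suc p = length a")
      case True
      then show ?thesis using block_mem_A_set[OF a_pos p that] by (simp add: q_def l_def start_row_def)
    next
      case False
      then show ?thesis using block_mem_A_set[OF a_pos p that] p by (auto simp: q_def l_def start_row_def)
    qed
    have aseq: "a_seq a (?q + i) = ?b @ [?m - i]"
      using a_seq_block[OF a_pos p that] by (simp add: q_def)
    have "n - (?q + i) = sum_list ?b + (?m - i)"
      using n_minus_q[of "Suc p"] p that by (simp add: sum_list_take_nth)
    then show ?thesis
      unfolding eff aseq using block[of i] that by (simp add: c_def l_def)
  qed
  then show "block_ok p"
    unfolding block_ok_def using block[of ?m] block_end(2) by (simp add: c0 cm l0)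
qed

lemma good: "p \<le> length a \<Longrightarrow> good p"
proof (induction p rule: inc_induct)
  case base
  then show ?case using mu sum_a tops_a_le by (simp add: good_def)
next
  case (step p)
  then show ?case by (auto intro: good_step(1))
qed

lemma block_ok: "p < length a \<Longrightarrow> block_ok p"
  using good_step(2) good by simp

lemma l_seq_mem:
  assumes "i < n"
  shows "is_partition (n - i) (mu_seq \<mu> a r i)"
    and "l_seq \<mu> a r (Suc i) \<in> R_set_from (mu_seq \<mu> a r i) (a_seq a i)
          (if i \<in> A_set a then 1 else l_seq \<mu> a r i)"
proof -
  have "i < sum_list a" using assms sum_a by simp
  then obtain p i' where p: "p < length a" "i' < a ! p" and i: "i = q (Suc p) + i'"
    by (rule block_exists) (auto simp: q_def)
  from block_ok[OF p(1)] p(2)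
  show "is_partition (n - i) (mu_seq \<mu> a r i)"
    and "l_seq \<mu> a r (Suc i) \<in> R_set_from (mu_seq \<mu> a r i) (a_seq a i)
          (if i \<in> A_set a then 1 else l_seq \<mu> a r i)"
    unfolding i block_ok_def by blast+
qed

lemma well_defined: "seqs_well_defined \<mu> a r"
  unfolding seqs_well_defined_def partition_sum_list[OF mu] using l_seq_mem(2) by blast

end

section \<open>Tableaux as chains of horizontal strips\<close>

lemma mem_diagram_iff: "(i, j) \<in> diagram c \<longleftrightarrow> 1 \<le> j \<and> j \<le> part c i"
  by (auto simp: diagram_def part_def)

lemma diagram_dec_part:
  assumes "1 \<le> i" "i \<le> length c" "0 < part c i"
  shows "diagram c = insert (i, part c i) (diagram (dec_part c i))"
    and "(i, part c i) \<notin> diagram (dec_part c i)"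
  using assms part_dec_part[OF assms(1,2)]
  by (auto simp: mem_diagram_iff split: if_splits)

lemma finite_diagram: "finite (diagram c)"
proof (rule finite_subset)
  show "diagram c \<subseteq> Sigma {1..length c} (\<lambda>i. {1..part c i})" by (auto simp: diagram_def)
qed simp

lemma down_closed_eq_atLeastAtMost:
  assumes "finite D" "\<And>j. j \<in> D \<Longrightarrow> 1 \<le> j" "\<And>j. 1 \<le> j \<Longrightarrow> Suc j \<in> D \<Longrightarrow> j \<in> D"
  shows "D = {1..card D}"
proof (cases "D = {}")
  case False
  have mem: "j \<in> D" if "j \<le> Max D" "1 \<le> j" for j
    using that(1)
  proof (induction j rule: inc_induct)
    case base
    show ?case using assms(1) False by (rule Max_in)
  next
    case (step i)
    then show ?case using assms(3)[of i] \<open>1 \<le> j\<close> by simp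
  qed
  have eq: "D = {1..Max D}"
  proof (rule equalityI; rule subsetI)
    show "j \<in> {1..Max D}" if "j \<in> D" for j using Max_ge[OF assms(1) that] assms(2)[OF that] by simp
    show "j \<in> D" if "j \<in> {1..Max D}" for j using that by (intro mem) simp_all
  qed
  then have "card D = card {1..Max D}" by (rule arg_cong)
  then have "card D = Max D" by simp
  then show ?thesis unfolding \<open>card D = Max D\<close> by (intro eq)
qed simp

lemma part_map_upt: "part (map f [1..<k + 1]) i = (if 1 \<le> i \<and> i \<le> k then f i else 0)"
  by (auto simp: part_def simp del: upt_Suc)

lemma part_row_counts:
  "part (row_counts \<mu> T p) i = card {j \<in> {1..part \<mu> i}. T (i, j) \<le> p}"
proof -
  have "part (row_counts \<mu> T p) i =
      part (map (\<lambda>i. card {j \<in> {1..part \<mu> i}. T (i, j) \<le> p}) [1..<length \<mu> + 1]) i"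
    by (simp only: row_counts_def part_strip_zeros)
  also have "\<dots> = card {j \<in> {1..part \<mu> i}. T (i, j) \<le> p}"
    by (simp only: part_map_upt) (auto simp: part_def)
  finally show ?thesis .
qed

lemma length_row_counts_le: "length (row_counts \<mu> T p) \<le> length \<mu>"
  unfolding row_counts_def
  by (rule order.trans[OF length_strip_zeros_le]) (simp del: upt_Suc)

section \<open>The shapes formed by the small entries of a semistandard tableau\<close>

locale tableau =
  fixes n :: nat and \<mu> a :: "nat list" and T :: "nat \<times> nat \<Rightarrow> nat"
  assumes mu: "is_partition n \<mu>" and a: "is_composition n a" and T: "T \<in> STab \<mu> a"
begin

abbreviation rc :: "nat \<Rightarrow> nat list" where "rc \<equiv> row_counts \<mu> T"

lemma T_range: "x \<in> diagram \<mu> \<Longrightarrow> 1 \<le> T x \<and> T x \<le> length a"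
  using T by (auto simp: STab_def PiE_iff)

lemma T_row: "(i, j) \<in> diagram \<mu> \<Longrightarrow> (i, Suc j) \<in> diagram \<mu> \<Longrightarrow> T (i, j) \<le> T (i, Suc j)"
  using T by (auto simp: STab_def)

lemma T_column: "(i, j) \<in> diagram \<mu> \<Longrightarrow> (Suc i, j) \<in> diagram \<mu> \<Longrightarrow> T (i, j) < T (Suc i, j)"
  using T by (auto simp: STab_def)

text \<open>Rows increase weakly, so the entries \<open>\<le> p\<close> of a row fill an initial
  segment, determined by its cardinality.\<close>

lemma T_le_iff:
  assumes "(i, j) \<in> diagram \<mu>"
  shows "T (i, j) \<le> p \<longleftrightarrow> j \<le> part (rc p) i"
proof -
  let ?D = "{j \<in> {1..part \<mu> i}. T (i, j) \<le> p}"
  have "?D = {1..card ?D}"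
  proof (rule down_closed_eq_atLeastAtMost)
    fix j assume "1 \<le> j" and j: "Suc j \<in> ?D"
    then have "T (i, j) \<le> T (i, Suc j)" by (intro T_row) (auto simp: mem_diagram_iff)
    then show "j \<in> ?D" using \<open>1 \<le> j\<close> j by auto
  qed auto
  moreover have "j \<in> ?D \<longleftrightarrow> T (i, j) \<le> p" using assms by (auto simp: mem_diagram_iff)
  ultimately have "T (i, j) \<le> p \<longleftrightarrow> j \<in> {1..card ?D}" by blast
  then show ?thesis using assms by (auto simp: part_row_counts mem_diagram_iff)
qed

lemma part_rc_le: "part (rc p) i \<le> part \<mu> i"
proof -
  have "card {j \<in> {1..part \<mu> i}. T (i, j) \<le> p} \<le> card {1..part \<mu> i}" by (intro card_mono) auto
  then show ?thesis by (simp add: part_row_counts)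
qed

lemma part_rc_mono: "part (rc p) i \<le> part (rc (Suc p)) i"
  unfolding part_row_counts by (intro card_mono) auto

text \<open>Column strictness at the last box of row \<open>i + 1\<close> with entry at most
  \<open>p + 1\<close>: the box above it has entry at most \<open>p\<close>.\<close>

lemma part_rc_interlace:
  assumes "1 \<le> i"
  shows "part (rc (Suc p)) (Suc i) \<le> part (rc p) i"
proof (cases "part (rc (Suc p)) (Suc i)")
  case (Suc j)
  let ?j = "part (rc (Suc p)) (Suc i)"
  have le: "?j \<le> part \<mu> (Suc i)" by (rule part_rc_le)
  then have x: "(Suc i, ?j) \<in> diagram \<mu>" using Suc by (simp add: mem_diagram_iff)
  moreover have y: "(i, ?j) \<in> diagram \<mu>"
    using le partition_part_antimono[OF mu assms, of "Suc i"] Suc by (simp add: mem_diagram_iff)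
  ultimately have "T (i, ?j) < T (Suc i, ?j)" by (intro T_column)
  moreover have "T (Suc i, ?j) \<le> Suc p" using T_le_iff[OF x, of "Suc p"] by simp
  ultimately have "T (i, ?j) \<le> p" by simp
  then show ?thesis using T_le_iff[OF y] by simp
qed simp

lemma card_T_le: "p \<le> length a \<Longrightarrow> card {x \<in> diagram \<mu>. T x \<le> p} = psum a p"
proof (induction p)
  case 0
  have "{x \<in> diagram \<mu>. T x \<le> 0} = {}" using T_range by fastforce
  then show ?case by (metis card.empty psum_0)
next
  case (Suc p)
  have "{x \<in> diagram \<mu>. T x \<le> Suc p} = {x \<in> diagram \<mu>. T x \<le> p} \<union> {x \<in> diagram \<mu>. T x = Suc p}"
    by auto
  moreover have "card \<dots> = card {x \<in> diagram \<mu>. T x \<le> p} + card {x \<in> diagram \<mu>. T x = Suc p}"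
    by (rule card_Un_disjoint) (auto simp: finite_diagram)
  moreover have "card {x \<in> diagram \<mu>. T x = Suc p} = part a (Suc p)"
    using T Suc.prems by (simp add: STab_def)
  ultimately show ?case using Suc by (simp add: psum_Suc)
qed

lemma sum_list_rc: "p \<le> length a \<Longrightarrow> sum_list (rc p) = psum a p"
proof -
  assume p: "p \<le> length a"
  have "sum_list (rc p) = psum (rc p) (length \<mu>)" by (simp add: psum_beyond length_row_counts_le)
  also have "\<dots> = (\<Sum>i=1..length \<mu>. card {j \<in> {1..part \<mu> i}. T (i, j) \<le> p})"
    by (simp add: psum_eq_sum_part part_row_counts)
  also have "\<dots> = card (Sigma {1..length \<mu>} (\<lambda>i. {j \<in> {1..part \<mu> i}. T (i, j) \<le> p}))"
    by simp
  also have "Sigma {1..length \<mu>} (\<lambda>i. {j \<in> {1..part \<mu> i}. T (i, j) \<le> p}) = {x \<in> diagram \<mu>. T x \<le> p}"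
    by (auto simp: diagram_def)
  finally show ?thesis using p by (simp add: card_T_le)
qed

lemma is_partition_rc: "p \<le> length a \<Longrightarrow> is_partition (psum a p) (rc p)"
proof -
  assume p: "p \<le> length a"
  let ?c = "map (\<lambda>i. card {j \<in> {1..part \<mu> i}. T (i, j) \<le> p}) [1..<length \<mu> + 1]"
  have eq: "part ?c i = part (rc p) i" for i by (simp only: row_counts_def part_strip_zeros)
  have "part ?c (Suc i) \<le> part ?c i" if "1 \<le> i" for i
    unfolding eq by (rule order.trans[OF part_rc_mono part_rc_interlace[OF that]])
  then have "is_partition (sum_list ?c) (rc p)"
    unfolding row_counts_def by (rule is_partition_strip_zeros)
  moreover have "sum_list ?c = psum a p"
    using sum_list_rc[OF p] by (simp only: row_counts_def sum_list_strip_zeros)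
  ultimately show ?thesis by simp
qed

lemma rc_length: "rc (length a) = \<mu>"
proof (rule positive_list_eqI)
  fix i
  have "{j \<in> {1..part \<mu> i}. T (i, j) \<le> length a} = {1..part \<mu> i}"
    using T_range by (auto simp: mem_diagram_iff)
  then show "part (rc (length a)) i = part \<mu> i" by (simp add: part_row_counts)
qed (use partition_pos[OF mu] partition_pos[OF is_partition_rc] in auto)

lemma rc_0: "rc 0 = []"
  using is_partition_rc[of 0] by (cases "rc 0") (auto simp: is_partition_def is_composition_def)

lemma strip_rc: "strip (psum (rc (Suc p))) (psum (rc p))"
  unfolding strip_def using part_rc_interlace part_rc_mono by (simp add: psum_Suc)

lemma total_rc:
  assumes "p < length a" "length \<mu> \<le> j"
  shows "psum (rc p) j + a ! p = psum (rc (Suc p)) j"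
proof -
  have "psum (rc s) j = psum a s" if "s \<le> length a" for s
    using psum_beyond[OF order.trans[OF length_row_counts_le assms(2)]] sum_list_rc[OF that] by simp
  from this[of p] this[of "Suc p"] show ?thesis using assms by (simp add: psum_Suc part_def)
qed

text \<open>The boxes with entry \<open>p + 1\<close> form a strip of size \<open>a ! p\<close>, so
  \<open>strip_dominance\<close> extends the bound by one entry of \<open>a\<close> at a
  time.\<close>

lemma tops_le_rc: "p \<le> length a \<Longrightarrow> tops (take p a) j \<le> psum (rc p) j"
proof (induction p arbitrary: j)
  case (Suc p)
  have tot: "\<forall>j\<ge>length \<mu>. psum (rc p) j + a ! p = psum (rc (Suc p)) j"
    using total_rc Suc.prems by simp
  have "\<forall>j. tops (take p a) j \<le> psum (rc p) j" using Suc by simp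
  note dom = strip_dominance[OF strip_rc mono_psum tot this]
  have "\<forall>j. tops (take p a @ [a ! p]) j \<le> psum (rc (Suc p)) j"
    using dom tops_snoc_le_iff[of "psum (rc (Suc p))"] by simp
  then show ?case using Suc.prems by (simp add: take_Suc_conv_app_nth)
qed simp

lemma feasible_rc:
  assumes "p < length a" "\<And>j. j < l \<Longrightarrow> psum (rc p) j = psum (rc (Suc p)) j"
  shows "feasible (length \<mu>) (psum (rc (Suc p))) (tops (take p a)) (a ! p) l (psum (rc p))"
  unfolding feasible_def using assms strip_rc total_rc tops_le_rc by simp

text \<open>A row ends in \<open>length a\<close> exactly when deleting the boxes with that entry
  shortens it. This turns the condition on the tableau into agreement of partial sums, as in
  \<open>feasible\<close>.\<close>

lemma Min_row_ge_iff:
  assumes "a \<noteq> []"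
  shows "s \<le> Min {i \<in> {1..length \<mu>}. T (i, part \<mu> i) = length a} \<longleftrightarrow>
         (\<forall>j<s. psum (rc (length a - 1)) j = psum \<mu> j)"
proof -
  let ?X = "{i \<in> {1..length \<mu>}. T (i, part \<mu> i) = length a}" and ?p = "length a - 1"
  have X_iff: "i \<in> ?X \<longleftrightarrow> part (rc ?p) i \<noteq> part \<mu> i" for i
  proof (cases "1 \<le> i \<and> i \<le> length \<mu>")
    case True
    then have x: "(i, part \<mu> i) \<in> diagram \<mu>"
      using part_pos[OF partition_pos[OF mu], of i] by (simp add: mem_diagram_iff)
    have "T (i, part \<mu> i) = length a \<longleftrightarrow> \<not> T (i, part \<mu> i) \<le> ?p"
      using T_range[OF x] assms by (cases a) auto
    then show ?thesis using True T_le_iff[OF x, of ?p] part_rc_le[of ?p i] by auto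
  next
    case False
    then have "part \<mu> i = 0" by (auto simp: part_def)
    then show ?thesis using False part_rc_le[of ?p i] by auto
  qed
  \<comment> \<open>\<open>Min\<close> is meaningful only on a nonempty set; the last entry of
    \<open>a\<close> is positive, so some row loses a box.\<close>
  have "?X \<noteq> {}"
  proof
    assume "?X = {}"
    then have "part (rc ?p) i = part \<mu> i" for i using X_iff[of i] by blast
    then have "sum_list (rc ?p) = sum_list \<mu>"
      by (metis (mono_tags, lifting) length_row_counts_le order_refl psum_beyond psum_eq_sum_part sum.cong)
    then have "psum a ?p = psum a (length a)"
      using sum_list_rc[of ?p] sum_list_rc[of "length a"] rc_length by simp
    moreover have "psum a (length a) = psum a ?p + part a (length a)"
      using psum_Suc[of a ?p] assms by simp
    moreover have "0 < part a (length a)"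
      using a assms by (intro part_pos) (auto simp: is_composition_def Suc_le_eq)
    ultimately show False by simp
  qed
  then have "s \<le> Min ?X \<longleftrightarrow> (\<forall>i\<in>?X. s \<le> i)" by (intro Min_ge_iff) auto
  also have "\<dots> \<longleftrightarrow> (\<forall>i<s. part (rc ?p) i = part \<mu> i)"
    using X_iff by (meson not_le)
  also have "\<dots> \<longleftrightarrow> (\<forall>j<s. psum (rc ?p) j = psum \<mu> j)"
  proof
    assume "\<forall>i<s. part (rc ?p) i = part \<mu> i"
    then show "\<forall>j<s. psum (rc ?p) j = psum \<mu> j" by (auto simp: psum_eq_sum_part intro!: sum.cong)
  next
    assume R: "\<forall>j<s. psum (rc ?p) j = psum \<mu> j"
    show "\<forall>i<s. part (rc ?p) i = part \<mu> i"
    proof (intro allI impI)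
      fix i assume "i < s"
      then show "part (rc ?p) i = part \<mu> i"
        using R[rule_format, of i] R[rule_format, of "i - 1"] by (cases i) (auto simp: psum_Suc)
    qed
  qed
  finally show ?thesis .
qed

end

text \<open>The row counts fix every relation \<open>S x \<le> p\<close>, and the thresholds
  \<open>p = S x\<close> and \<open>p = T x\<close> then force equality.\<close>

lemma row_counts_determine:
  assumes "tableau n \<mu> a S" "tableau n \<mu> a T"
    and "\<And>p. p \<le> length a \<Longrightarrow> row_counts \<mu> S p = row_counts \<mu> T p"
  shows "S = T"
proof -
  interpret S: tableau n \<mu> a S by (rule assms(1))
  interpret T: tableau n \<mu> a T by (rule assms(2))
  show ?thesis
  proof (rule extensionalityI[where A = "diagram \<mu>"])
    show "S \<in> extensional (diagram \<mu>)" "T \<in> extensional (diagram \<mu>)"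
      using S.T T.T by (auto simp: STab_def PiE_def)
    fix x assume x: "x \<in> diagram \<mu>"
    obtain i j where ij: "x = (i, j)" by (cases x)
    have "S x \<le> p \<longleftrightarrow> T x \<le> p" if "p \<le> length a" for p
      using S.T_le_iff[of i j p] T.T_le_iff[of i j p] x assms(3)[OF that] by (simp add: ij)
    from this[of "S x"] this[of "T x"] show "S x = T x"
      using S.T_range[OF x] T.T_range[OF x] by simp
  qed
qed

section \<open>The constructed tableau and its minimality\<close>

context greedy_setup
begin

definition cell :: "nat \<Rightarrow> nat \<times> nat" where
  "cell i = (l_seq \<mu> a r (Suc i), part (mu_seq \<mu> a r i) (l_seq \<mu> a r (Suc i)))"

lemma q_antimono: "p \<le> p' \<Longrightarrow> q p' \<le> q p"
  by (simp add: q_def sum_list_drop_antimono)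

lemma q_0 [simp]: "q 0 = n"
  by (simp add: q_def sum_a)

lemma shape_0: "shape 0 = []"
  using good[of 0] by (cases "shape 0") (auto simp: good_def is_partition_def is_composition_def)

lemma diagram_mu_seq_Suc:
  assumes "i < n"
  shows "diagram (mu_seq \<mu> a r i) = insert (cell i) (diagram (mu_seq \<mu> a r (Suc i)))"
    and "cell i \<notin> diagram (mu_seq \<mu> a r (Suc i))"
proof -
  have "l_seq \<mu> a r (Suc i) \<in> R_set (mu_seq \<mu> a r i) (a_seq a i)"
    using l_seq_mem(2)[OF assms] unfolding R_set_from_def by blast
  then have "1 \<le> l_seq \<mu> a r (Suc i)" "l_seq \<mu> a r (Suc i) \<le> length (mu_seq \<mu> a r i)"
    "0 < part (mu_seq \<mu> a r i) (l_seq \<mu> a r (Suc i))"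
    unfolding R_set_def by auto
  from diagram_dec_part[OF this]
  show "diagram (mu_seq \<mu> a r i) = insert (cell i) (diagram (mu_seq \<mu> a r (Suc i)))"
    "cell i \<notin> diagram (mu_seq \<mu> a r (Suc i))"
    unfolding cell_def mu_seq.simps by blast+
qed

lemma diagram_mu_seq: "i \<le> n \<Longrightarrow> diagram (mu_seq \<mu> a r i) = cell ` {i..<n}"
proof (induction i rule: inc_induct)
  case base
  show ?case using shape_0 by (simp add: shape_def diagram_def)
next
  case (step i)
  then have "{i..<n} = insert i {Suc i..<n}" by auto
  then show ?case using step diagram_mu_seq_Suc(1)[of i] by simp
qed

text \<open>A box removed in step \<open>i\<close> is missing from all later shapes, which contain
  the boxes of the later steps. Thus the prescribed values of \<open>S\<close> cannot
  conflict.\<close>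

lemma inj_cell: "inj_on cell {..<n}"
proof -
  have "cell i \<noteq> cell j" if "i < j" "j < n" for i j
    using diagram_mu_seq_Suc(2)[of i] diagram_mu_seq[of "Suc i"] that by auto
  then show ?thesis by (auto simp: inj_on_def) (metis linorder_neqE_nat)
qed

lemma diagram_mu: "diagram \<mu> = cell ` {..<n}"
  using diagram_mu_seq[of 0] by (simp add: atLeast0LessThan)

text \<open>The value \<open>t\<close> of the construction, expressed through the antitone
  \<open>q\<close> so that thresholds on entries become thresholds on step numbers.\<close>

definition entry :: "nat \<Rightarrow> nat" where
  "entry i = (LEAST t. q t \<le> i)"

lemma entry_le_iff: "entry i \<le> p \<longleftrightarrow> q p \<le> i"
proof
  have "q (length a) \<le> i" by simp
  then have "q (entry i) \<le> i" unfolding entry_def by (rule LeastI)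
  then show "q p \<le> i" if "entry i \<le> p" using q_antimono[OF that] by simp
qed (auto simp: entry_def intro: Least_le)

lemma entry_range: "i < n \<Longrightarrow> entry i \<in> {1..length a}"
  using entry_le_iff[of i 0] entry_le_iff[of i "length a"] by (simp add: Suc_le_eq)

lemma psum_plus_q: "t \<le> length a \<Longrightarrow> psum a t + q t = n"
  by (metis append_take_drop_id psum_def q_def sum_a sum_list_append)

text \<open>Since \<open>psum a t = n - q t\<close>, the two bounds say
  \<open>q t \<le> i < q (t - 1)\<close>.\<close>

lemma entry_unique:
  assumes "i < n" "t \<in> {1..length a}"
  shows "(\<Sum>j=1..<t. part a j) < n - i \<and> n - i \<le> (\<Sum>j=1..t. part a j) \<longleftrightarrow> t = entry i"
proof -
  obtain s where t: "t = Suc s" using assms(2) by (cases t) auto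
  have "(\<Sum>j=1..<t. part a j) = psum a s"
    by (simp add: t psum_eq_sum_part atLeastLessThanSuc_atLeastAtMost)
  moreover have "(\<Sum>j=1..t. part a j) = psum a t"
    by (simp add: psum_eq_sum_part)
  moreover have "psum a s + q s = n" "psum a t + q t = n"
    using psum_plus_q assms(2) t by auto
  ultimately have "(\<Sum>j=1..<t. part a j) < n - i \<and> n - i \<le> (\<Sum>j=1..t. part a j) \<longleftrightarrow> i < q s \<and> q t \<le> i"
    using assms(1) by linarith
  also have "\<dots> \<longleftrightarrow> t = entry i"
    using entry_le_iff[of i s] entry_le_iff[of i t] t by auto
  finally show ?thesis .
qed

lemma is_constructed_tab_iff:
  "is_constructed_tab \<mu> a r S \<longleftrightarrow>
     S \<in> extensional (diagram \<mu>) \<and> (\<forall>i<n. S (cell i) = entry i)"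
proof -
  have "(\<exists>t\<in>{1..length a}. (\<Sum>j=1..<t. part a j) < n - i \<and> n - i \<le> (\<Sum>j=1..t. part a j) \<and>
          S (cell i) = t) \<longleftrightarrow> S (cell i) = entry i" if "i < n" for i
    using entry_unique[OF that] entry_range[OF that] by metis
  then show ?thesis
    unfolding is_constructed_tab_def partition_sum_list[OF mu] by (simp add: cell_def)
qed

lemma constructed_tab_unique: "\<exists>!S. is_constructed_tab \<mu> a r S"
proof (rule ex_ex1I)
  let ?S = "restrict (\<lambda>x. entry (inv_into {..<n} cell x)) (diagram \<mu>)"
  have "?S (cell i) = entry i" if "i < n" for i
    using that inj_cell by (simp add: diagram_mu inv_into_f_f)
  then show "\<exists>S. is_constructed_tab \<mu> a r S" by (auto simp: is_constructed_tab_iff intro!: exI[of _ ?S])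
next
  fix S S' assume "is_constructed_tab \<mu> a r S" "is_constructed_tab \<mu> a r S'"
  then show "S = S'"
    by (intro extensionalityI[where A = "diagram \<mu>"]) (auto simp: is_constructed_tab_iff diagram_mu)
qed

lemma part_shape_interlace:
  assumes "p < length a" "1 \<le> i"
  shows "part (shape (Suc p)) (Suc i) \<le> part (shape p) i"
proof -
  obtain j where i: "i = Suc j" using assms(2) by (cases i) auto
  have "strip (psum (shape (Suc p))) (psum (shape p))" using block_ok[OF assms(1)] by (simp add: block_ok_def)
  then have "psum (shape (Suc p)) (Suc (Suc j)) + psum (shape p) j
      \<le> psum (shape (Suc p)) (Suc j) + psum (shape p) (Suc j)"
    unfolding strip_def by blast
  then show ?thesis by (simp add: i psum_Suc)
qed

lemma diagram_shape_subset: "diagram (shape p) \<subseteq> diagram \<mu>"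
  unfolding shape_def using q_le_n[of p] by (auto simp: diagram_mu_seq diagram_mu)

context
  fixes S assumes S: "is_constructed_tab \<mu> a r S"
begin

lemma S_cell: "i < n \<Longrightarrow> S (cell i) = entry i"
  using S by (simp add: is_constructed_tab_iff)

lemma S_le_iff:
  assumes "x \<in> diagram \<mu>"
  shows "S x \<le> p \<longleftrightarrow> x \<in> diagram (shape p)"
proof -
  obtain i where i: "i < n" "x = cell i" using assms by (auto simp: diagram_mu)
  have "x \<in> diagram (shape p) \<longleftrightarrow> cell i \<in> cell ` {q p..<n}"
    unfolding shape_def i(2) using diagram_mu_seq[OF q_le_n] by simp
  also have "\<dots> \<longleftrightarrow> i \<in> {q p..<n}"
    using i(1) by (intro inj_on_image_mem_iff[OF inj_cell]) auto
  finally show ?thesis using i entry_le_iff[of i p] by (simp add: S_cell)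
qed

text \<open>Rows are weakly increasing because each \<open>shape p\<close> is left-justified,
  columns are strict because consecutive shapes interlace, and the weight is right because each
  block has \<open>q s - q (Suc s) = a ! s\<close> steps.\<close>

lemma constructed_in_STab: "S \<in> STab \<mu> a"
  unfolding STab_def
proof (intro CollectI conjI allI impI ballI)
  have range: "S x \<in> {1..length a}" if "x \<in> diagram \<mu>" for x
    using that entry_range by (auto simp: diagram_mu S_cell)
  then show "S \<in> diagram \<mu> \<rightarrow>\<^sub>E {1..length a}"
    using S by (auto simp: is_constructed_tab_iff PiE_iff)
  show "S (i, j) \<le> S (i, j + 1)" if "(i, j) \<in> diagram \<mu> \<and> (i, j + 1) \<in> diagram \<mu>" for i j
  proof -
    have "(i, j + 1) \<in> diagram (shape (S (i, j + 1)))" using S_le_iff that by blast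
    then have "(i, j) \<in> diagram (shape (S (i, j + 1)))"
      using that by (auto simp: mem_diagram_iff)
    then show ?thesis using S_le_iff that by blast
  qed
  show "S (i, j) < S (i + 1, j)" if "(i, j) \<in> diagram \<mu> \<and> (i + 1, j) \<in> diagram \<mu>" for i j
  proof -
    have "S (i + 1, j) \<in> {1..length a}" using that range by blast
    then obtain p where p: "S (i + 1, j) = Suc p" "p < length a" by (cases "S (i + 1, j)") auto
    have "(i + 1, j) \<in> diagram (shape (Suc p))" using S_le_iff[of "(i + 1, j)" "Suc p"] that p by simp
    moreover have "1 \<le> i" using that by (auto simp: diagram_def)
    ultimately have "(i, j) \<in> diagram (shape p)"
      using part_shape_interlace[OF p(2), of i] by (auto simp: mem_diagram_iff)
    then have "S (i, j) \<le> p" using S_le_iff that by blast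
    then show ?thesis using p by simp
  qed
  show "card {c \<in> diagram \<mu>. S c = t} = part a t" if t: "t \<in> {1..length a}" for t
  proof -
    obtain s where s: "t = Suc s" "s < length a" using t by (cases t) auto
    have "{c \<in> diagram \<mu>. S c = t} = cell ` {i \<in> {..<n}. entry i = t}"
      by (auto simp: diagram_mu S_cell)
    moreover have "{i \<in> {..<n}. entry i = t} = {q t..<q s}"
    proof (rule set_eqI)
      fix i
      have "entry i = t \<longleftrightarrow> q t \<le> i \<and> i < q s"
        using entry_le_iff[of i s] entry_le_iff[of i t] s by auto
      moreover have "i < n" if "i < q s" using that q_le_n[of s] by (rule less_le_trans)
      ultimately show "i \<in> {i \<in> {..<n}. entry i = t} \<longleftrightarrow> i \<in> {q t..<q s}"
        unfolding mem_Collect_eq lessThan_iff atLeastLessThan_iff by blast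
    qed
    moreover have "card (cell ` {q t..<q s}) = q s - q t"
    proof -
      have "{q t..<q s} \<subseteq> {..<n}" using q_le_n[of s] by auto
      then show ?thesis using card_image[OF inj_on_subset[OF inj_cell]] by (metis card_atLeastLessThan)
    qed
    ultimately show ?thesis using q_Suc[of s] s by (simp add: part_def)
  qed
qed

lemma tableau_S: "tableau n \<mu> a S"
  by (intro tableau.intro mu a constructed_in_STab)

lemma row_counts_S:
  assumes "p \<le> length a"
  shows "row_counts \<mu> S p = shape p"
proof (rule positive_list_eqI)
  show "\<forall>x\<in>set (row_counts \<mu> S p). 0 < x"
    using partition_pos[OF tableau.is_partition_rc[OF tableau_S assms]] .
  show "\<forall>x\<in>set (shape p). 0 < x"
    using good[OF assms] partition_pos unfolding good_def by blast
  fix i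
  have "j \<in> {1..part \<mu> i} \<and> S (i, j) \<le> p \<longleftrightarrow> j \<in> {1..part (shape p) i}" for j
    using S_le_iff[of "(i, j)" p] subsetD[OF diagram_shape_subset[of p], of "(i, j)"]
    by (auto simp: mem_diagram_iff)
  then have "{j \<in> {1..part \<mu> i}. S (i, j) \<le> p} = {1..part (shape p) i}" by blast
  then show "part (row_counts \<mu> S p) i = part (shape p) i" by (simp add: part_row_counts)
qed

text \<open>At the largest \<open>p\<close> where the row counts differ, both shapes arise from the
  same \<open>shape (Suc p)\<close> by removing a strip of size \<open>a ! p\<close>. That of
  \<open>T\<close> is feasible, so the minimality in \<open>block_ok\<close> applies.\<close>

lemma constructed_tab_le:
  assumes T: "T \<in> STab \<mu> a"
    and rows: "\<forall>j<r. psum (row_counts \<mu> T (length a - 1)) j = psum \<mu> j"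
  shows "tab_le \<mu> a S T"
proof (cases "S = T")
  case False
  interpret T: tableau n \<mu> a T by (intro tableau.intro mu a T)
  interpret S: tableau n \<mu> a S by (rule tableau_S)
  let ?P = "\<lambda>p. p \<le> length a \<and> row_counts \<mu> S p \<noteq> row_counts \<mu> T p"
  define p where "p = (GREATEST p. ?P p)"
  have "\<exists>p. ?P p" using False row_counts_determine[OF tableau_S T.tableau_axioms] by blast
  then have p: "?P p" unfolding p_def by (rule GreatestI_ex_nat[where b = "length a"]) simp
  have above: "row_counts \<mu> T p' = row_counts \<mu> S p'" if "p < p'" "p' \<le> length a" for p'
    using that Greatest_le_nat[of ?P p' "length a"] unfolding p_def by fastforce
  \<comment> \<open>At 0 both shapes are empty and at \<open>length a\<close> both are
    \<open>\<mu>\<close>, so neither can be a place of disagreement.\<close>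
  have "p \<noteq> 0" using p S.rc_0 T.rc_0 by metis
  have "p \<noteq> length a" using p S.rc_length T.rc_length by metis
  then have lt: "p < length a" using p by simp
  have Suc_eq: "row_counts \<mu> T (Suc p) = shape (Suc p)"
    using above[of "Suc p"] row_counts_S[of "Suc p"] lt by simp
  have "psum (row_counts \<mu> T p) j = psum (row_counts \<mu> T (Suc p)) j" if "j < start_row p" for j
  proof (cases "Suc p = length a")
    case True
    then have "p = length a - 1" "j < r" using that by (auto simp: start_row_def)
    then show ?thesis using rows True T.rc_length by simp
  next
    case False
    then show ?thesis using that by (simp add: start_row_def)
  qed
  from T.feasible_rc[OF lt this]
  have "\<forall>j. psum (shape p) j \<le> psum (row_counts \<mu> T p) j"
    using block_ok[OF lt] unfolding block_ok_def Suc_eq by blast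
  then have "row_counts \<mu> T p \<unrhd> row_counts \<mu> S p"
    using dominates_iff_psum[OF partition_pos[OF T.is_partition_rc], of p "row_counts \<mu> S p"]
      S.sum_list_rc[of p] T.sum_list_rc[of p] row_counts_S[of p] lt by simp
  then have "row_counts \<mu> T p \<rhd> row_counts \<mu> S p"
    using p by (auto simp: strictly_dominates_def)
  then show ?thesis
    unfolding tab_le_def using above lt \<open>p \<noteq> 0\<close> by (intro disjI2 bexI[of _ p]) auto
qed (simp add: tab_le_def)

lemma constructed_tab_rows: "\<forall>j<r. psum (row_counts \<mu> S (length a - 1)) j = psum \<mu> j"
proof -
  have "length a - 1 < length a" "Suc (length a - 1) = length a" using a_ne by auto
  then show ?thesis
    using block_ok[of "length a - 1"] row_counts_S[of "length a - 1"]
    by (auto simp: block_ok_def start_row_def)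
qed

end

text \<open>For the least \<open>r\<close> the row restriction holds automatically: the top row of
  the strip of largest entries of any tableau lies in \<open>R_set\<close>. Taking
  \<open>l = 0\<close> in \<open>feasible\<close> imposes no row restriction in advance.\<close>

lemma rows_if_l_min:
  assumes "r = l_min \<mu> a" "T \<in> STab \<mu> a"
  shows "\<forall>j<r. psum (row_counts \<mu> T (length a - 1)) j = psum \<mu> j"
proof -
  interpret T: tableau n \<mu> a T by (intro tableau.intro mu a assms(2))
  let ?p = "length a - 1"
  have p: "?p < length a" "Suc ?p = length a" using a_ne by auto
  have "sum_list (take ?p a) + a ! ?p = n" using sum_a a_snoc
    by (metis (no_types, lifting) sum_list_append sum_list.Cons sum_list.Nil add_0_right)
  then have part: "is_partition (sum_list (take ?p a) + a ! ?p) \<mu>" using mu by simp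
  have "feasible (length \<mu>) (psum \<mu>) (tops (take ?p a)) (a ! ?p) 0 (psum (row_counts \<mu> T ?p))"
    using T.feasible_rc[OF p(1), of 0] unfolding p(2) T.rc_length by simp
  from feasible_first_row[OF part nth_a_pos[OF p(1)] this]
  obtain f where f: "f \<in> R_set_from \<mu> a 0" "\<And>j. j < f \<Longrightarrow> psum (row_counts \<mu> T ?p) j = psum \<mu> j"
    unfolding a_snoc[symmetric] by blast
  have "r \<le> f"
    unfolding assms(1) l_min_def using f(1) by (intro Min_le) (auto simp: R_set_from_def R_set_def)
  then show ?thesis using f(2) by simp
qed

end

theorem theorem5p6:
  fixes n r :: nat and \<mu> a :: "nat list"
  assumes "is_partition n \<mu>"
    and "is_composition n a"
    and "\<mu> \<unrhd> nonincr_rearr a"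
    and "r \<in> R_set \<mu> a"
    and "r \<le> s_index \<mu> a"
  shows "seqs_well_defined \<mu> a r \<and>
    (\<exists>!S. is_constructed_tab \<mu> a r S) \<and>
    (\<forall>S. is_constructed_tab \<mu> a r S \<longrightarrow>
       is_least_tab \<mu> a
         {T \<in> STab \<mu> a. Min {i \<in> {1..length \<mu>}. T (i, part \<mu> i) = length a} \<ge> r} S \<and>
       (r = l_min \<mu> a \<longrightarrow> is_least_tab \<mu> a (STab \<mu> a) S))"
proof -
  interpret greedy_setup n r \<mu> a by (intro greedy_setup.intro assms)
  have Min_iff: "r \<le> Min {i \<in> {1..length \<mu>}. T (i, part \<mu> i) = length a} \<longleftrightarrow>
      (\<forall>j<r. psum (row_counts \<mu> T (length a - 1)) j = psum \<mu> j)" if "T \<in> STab \<mu> a" for T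
    by (rule tableau.Min_row_ge_iff[OF tableau.intro[OF assms(1,2) that] a_ne])
  show ?thesis
    using well_defined constructed_tab_unique constructed_in_STab constructed_tab_rows
      constructed_tab_le rows_if_l_min Min_iff
    unfolding is_least_tab_def by auto
qed

end
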